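(* Let $0\leqslant\xi\leqslant\omega_1$ be an ordinal, let $X$ be a Banach space and let $K\subset X$. Then $K$ is $\xi$-weakly precompact if and only if its weak closure $\overline{K}^{\text{weak}}$ is $\xi$-weakly compact.
   Context: Banach spaces are over $\mathbb{K}\in\{\mathbb{R},\mathbb{C}\}$; $\mathbb{N}=\{1,2,\ldots\}$; $\omega_1$ is the first uncountable ordinal. For subsets $E,F$ of $\mathbb{N}$, $E<F$ means $\max E<\min F$ (with $\max\varnothing=0$, $\min\varnothing=\infty$), and $n\leqslant E$ means $n\leqslant\min E$. Schreier families $\mathcal{S}_\xi$ ($\xi<\omega_1$), families of finite subsets of $\mathbb{N}$: $\mathcal{S}_0=\{\varnothing\}\cup\{\{n\}:n\in\mathbb{N}\}$; $\mathcal{S}_{\xi+1}=\{\varnothing\}\cup\{\bigcup_{i=1}^nE_i: \varnothing\neq E_i\in\mathcal{S}_\xi,\ E_1<\ldots<E_n,\ n\leqslant\min E_1\}$; and for $\xi$ a limit ordinal, one fixes a sequence of ordinals $\xi_n\uparrow\xi$ and sets $\mathcal{S}_\xi=\{E: \exists n\in\mathbb{N},\ n\leqslant E\in\mathcal{S}_{\xi_n}\}$. For $0<\xi<\omega_1$, a sequence $(x_n)_{n=1}^\infty$ in a Banach space is an $\ell_1^\xi$-spreading model if $0<\inf\{\|x\|: E\in\mathcal{S}_\xi,\ x=\sum_{n\in E}a_nx_n,\ \sum_{n\in E}|a_n|=1\}$. For $0<\xi<\omega_1$, $(x_n)_{n=1}^\infty\subset X$ is $\xi$-weakly convergent to $x\in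 X$ if it converges weakly to $x$ and no subsequence of $(x_n-x)_{n=1}^\infty$ is an $\ell_1^\xi$-spreading model. $0$-weakly convergent means norm convergent, and $\omega_1$-weakly convergent means weakly convergent. A subset $K$ of a Banach space $X$ is $\xi$-weakly precompact (resp. $\xi$-weakly compact) if every sequence in $K$ has a subsequence which is $\xi$-weakly convergent to some member of $X$ (resp. of $K$). *)

theory Defs
  imports "HOL-Analysis.Analysis" "HOL-Library.Countable_Set_Type"
begin

section \<open>Ordinals\<close>

text \<open>
  All statements concern ordinals \<open>\<xi> \<le> \<omega>\<^sub>1\<close>. As a well-ordered type containing \<open>\<omega>\<^sub>1\<close> we use the
  ordinals below \<open>\<omega>\<^sub>2\<close>, that is, the field of the second successor cardinal of \<open>\<aleph>\<^sub>0\<close>.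
\<close>

abbreviation omega2_rel :: "nat set set rel" where
  "omega2_rel \<equiv> cardSuc (cardSuc natLeq)"

lemma Card_order_omega1_rel: "Card_order (cardSuc natLeq)"
  by (simp add: cardSuc_Card_order natLeq_Card_order)

lemma Card_order_omega2_rel: "Card_order omega2_rel"
  by (simp add: cardSuc_Card_order Card_order_omega1_rel)

lemma infinite_Field_omega2_rel: "infinite (Field omega2_rel)"
  using cardSuc_finite[OF Card_order_omega1_rel] cardSuc_finite[OF natLeq_Card_order]
  by (simp add: Field_natLeq)

lemma Well_order_omega2_rel: "Well_order omega2_rel"
  using Card_order_omega2_rel by (simp add: card_order_on_well_order_on)

typedef ordinal = "Field omega2_rel"
  using infinite_imp_nonempty[OF infinite_Field_omega2_rel] by (simp add: ex_in_conv)

instantiation ordinal :: wellorder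
begin

definition less_eq_ordinal :: "ordinal \<Rightarrow> ordinal \<Rightarrow> bool" where
  "\<xi> \<le> \<eta> \<longleftrightarrow> (Rep_ordinal \<xi>, Rep_ordinal \<eta>) \<in> omega2_rel"

definition less_ordinal :: "ordinal \<Rightarrow> ordinal \<Rightarrow> bool" where
  "\<xi> < \<eta> \<longleftrightarrow> \<xi> \<le> \<eta> \<and> \<not> \<eta> \<le> (\<xi> :: ordinal)"

instance
proof
  have refl: "\<And>a. a \<in> Field omega2_rel \<Longrightarrow> (a, a) \<in> omega2_rel"
    and trans: "trans omega2_rel" and antisym: "antisym omega2_rel"
    and total: "total_on (Field omega2_rel) omega2_rel"
    using Well_order_omega2_rel
    by (simp_all only: well_order_on_def linear_order_on_def partial_order_on_def
        preorder_on_def refl_on_def)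
  fix x y z :: ordinal
  show "x < y \<longleftrightarrow> x \<le> y \<and> \<not> y \<le> x"
    by (simp only: less_ordinal_def)
  show "x \<le> x"
    unfolding less_eq_ordinal_def by (rule refl[OF Rep_ordinal])
  show "x \<le> y \<Longrightarrow> y \<le> z \<Longrightarrow> x \<le> z"
    unfolding less_eq_ordinal_def by (rule transD[OF trans])
  show "x \<le> y \<Longrightarrow> y \<le> x \<Longrightarrow> x = y"
    unfolding less_eq_ordinal_def by (rule Rep_ordinal_inject[THEN iffD1], rule antisymD[OF antisym])
  show "x \<le> y \<or> y \<le> x"
    unfolding less_eq_ordinal_def
    by (cases "Rep_ordinal x = Rep_ordinal y")
      (simp_all only: refl[OF Rep_ordinal] simp_thms, rule total[unfolded total_on_def, rule_format, OF Rep_ordinal Rep_ordinal])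
next
  fix P :: "ordinal \<Rightarrow> bool" and a :: ordinal
  assume step: "\<And>x. (\<And>y. y < x \<Longrightarrow> P y) \<Longrightarrow> P x"
  have "wf (omega2_rel - Id)"
    using Well_order_omega2_rel by (simp add: well_order_on_def)
  then have "wf (inv_image (omega2_rel - Id) Rep_ordinal)"
    by (rule wf_inv_image)
  then show "P a"
  proof (induction a rule: wf_induct_rule)
    case (less x)
    show ?case
    proof (rule step)
      fix y assume "y < x"
      then show "P y"
        by (intro less) (simp add: less_ordinal_def less_eq_ordinal_def in_inv_image, metis)
    qed
  qed
qed

end

instantiation ordinal :: zero
begin

definition zero_ordinal :: ordinal where
  "(0 :: ordinal) = (LEAST \<xi>. True)"

instance ..

end

definition ord_succ :: "ordinal \<Rightarrow> ordinal" where
  "ord_succ \<xi> = (LEAST \<eta>. \<xi> < \<eta>)"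

definition is_limit :: "ordinal \<Rightarrow> bool" where
  "is_limit \<xi> \<longleftrightarrow> \<xi> \<noteq> 0 \<and> (\<forall>\<eta>. \<xi> \<noteq> ord_succ \<eta>)"

definition omega1 :: ordinal where
  "omega1 = (LEAST \<xi>. uncountable {..<\<xi>})"

lemma ordinal_zero_le [simp]: "0 \<le> (\<xi> :: ordinal)"
  unfolding zero_ordinal_def by (rule Least_le) simp

lemma ordinal_gt_ex: "\<exists>\<eta>. \<xi> < (\<eta> :: ordinal)"
proof -
  obtain b where b: "b \<in> Field omega2_rel" "Rep_ordinal \<xi> \<noteq> b" "(Rep_ordinal \<xi>, b) \<in> omega2_rel"
    using infinite_Card_order_limit[OF Card_order_omega2_rel infinite_Field_omega2_rel Rep_ordinal]
    by blast
  then have "\<xi> \<le> Abs_ordinal b" "\<xi> \<noteq> Abs_ordinal b"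
    by (auto simp: less_eq_ordinal_def Abs_ordinal_inverse)
  then show ?thesis
    using order_le_neq_trans by blast
qed

lemma less_ord_succ: "\<xi> < ord_succ \<xi>"
  unfolding ord_succ_def by (rule LeastI_ex[OF ordinal_gt_ex])

lemma ord_succ_le_iff: "ord_succ \<xi> \<le> \<eta> \<longleftrightarrow> \<xi> < \<eta>"
proof
  show "ord_succ \<xi> \<le> \<eta> \<Longrightarrow> \<xi> < \<eta>"
    by (rule less_le_trans[OF less_ord_succ])
  show "\<xi> < \<eta> \<Longrightarrow> ord_succ \<xi> \<le> \<eta>"
    unfolding ord_succ_def by (rule Least_le)
qed

lemma ord_succ_inject [simp]: "ord_succ \<xi> = ord_succ \<eta> \<longleftrightarrow> \<xi> = \<eta>"
proof
  assume eq: "ord_succ \<xi> = ord_succ \<eta>"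
  have "\<xi> < \<zeta> \<longleftrightarrow> \<eta> < \<zeta>" for \<zeta>
    using ord_succ_le_iff[of \<xi> \<zeta>] ord_succ_le_iff[of \<eta> \<zeta>] eq by simp
  from this[of \<xi>] this[of \<eta>] show "\<xi> = \<eta>"
    by (meson less_irrefl linorder_cases)
qed simp

lemma ord_succ_neq_zero [simp]: "ord_succ \<xi> \<noteq> 0"
  using less_le_trans[OF less_ord_succ] ordinal_zero_le[of \<xi>] by (metis less_ord_succ leD)

lemma not_is_limit_zero [simp]: "\<not> is_limit 0"
  and not_is_limit_succ [simp]: "\<not> is_limit (ord_succ \<xi>)"
  by (auto simp: is_limit_def)

context includes cardinal_syntax begin

lemma uncountable_lessThan_ex: "\<exists>\<xi> :: ordinal. uncountable {..<\<xi>}"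
proof -
  have "cardSuc natLeq <o omega2_rel"
    by (rule cardSuc_greater[OF Card_order_omega1_rel])
  then obtain a where a: "a \<in> Field omega2_rel"
    and iso: "cardSuc natLeq =o Restr omega2_rel (underS omega2_rel a)"
    using ordLess_iff_ordIso_Restr[OF Well_order_omega2_rel cardSuc_Card_order[THEN
          card_order_on_well_order_on, OF natLeq_Card_order]] by blast
  have sub: "underS omega2_rel a \<subseteq> Rep_ordinal ` {..<Abs_ordinal a}"
  proof
    fix b assume b: "b \<in> underS omega2_rel a"
    then have bF: "b \<in> Field omega2_rel"
      unfolding underS_def Field_def by fast
    have "Abs_ordinal b \<le> Abs_ordinal a" "Abs_ordinal b \<noteq> Abs_ordinal a"
      using b a bF
      by (simp_all add: underS_def less_eq_ordinal_def Abs_ordinal_inverse Abs_ordinal_inject)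
    then show "b \<in> Rep_ordinal ` {..<Abs_ordinal a}"
      by (intro image_eqI[of _ _ "Abs_ordinal b"]) (simp_all add: Abs_ordinal_inverse bF)
  qed
  have "uncountable (Field (cardSuc natLeq))"
  proof
    assume "countable (Field (cardSuc natLeq))"
    then have "|Field (cardSuc natLeq)| \<le>o natLeq"
      by (simp only: countable_card_le_natLeq)
    then have "cardSuc natLeq \<le>o natLeq"
      using card_of_Field_ordIso[OF Card_order_omega1_rel] ordIso_ordLeq_trans ordIso_symmetric
      by blast
    then show False
      using cardSuc_greater[OF natLeq_Card_order] not_ordLess_ordLeq by blast
  qed
  moreover obtain f where "bij_betw f (Field (cardSuc natLeq)) (Field (Restr omega2_rel (underS omega2_rel a)))"
    using iso unfolding ordIso_def iso_def by fast
  ultimately have "uncountable (Field (Restr omega2_rel (underS omega2_rel a)))"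
    using countableI_bij2 by metis
  moreover have "Field (Restr omega2_rel (underS omega2_rel a)) \<subseteq> underS omega2_rel a"
    unfolding Field_def by fast
  ultimately have "uncountable (Rep_ordinal ` {..<Abs_ordinal a})"
    using sub by (meson countable_subset order_trans)
  then have "uncountable {..<Abs_ordinal a}"
    using countable_image[of "{..<Abs_ordinal a}" Rep_ordinal] by argo
  then show ?thesis ..
qed

end

lemma uncountable_lessThan_omega1: "uncountable {..<omega1}"
  unfolding omega1_def by (rule LeastI_ex[OF uncountable_lessThan_ex])

lemma less_omega1_iff: "\<xi> < omega1 \<longleftrightarrow> countable {..<\<xi>}"
proof
  show "\<xi> < omega1 \<Longrightarrow> countable {..<\<xi>}"
    unfolding omega1_def using not_less_Least by blast
  show "countable {..<\<xi>} \<Longrightarrow> \<xi> < omega1"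
    using uncountable_lessThan_omega1 by (meson countable_subset lessThan_subset_iff not_le)
qed

section \<open>Schreier families\<close>

text \<open>
  The fixed sequences \<open>\<xi>\<^sub>n \<up> \<xi>\<close> for countable limit ordinals \<open>\<xi>\<close> are given by a function
  \<open>\<phi>\<close> with \<open>\<xi>\<^sub>n = \<phi> \<xi> n\<close>. Only indices \<open>n \<ge> 1\<close> are used.
  The arrow is read as: nondecreasing, below \<open>\<xi>\<close>, with supremum \<open>\<xi>\<close>; in particular every strictly
  increasing choice is admitted.
\<close>

definition fundamental_sequences :: "(ordinal \<Rightarrow> nat \<Rightarrow> ordinal) \<Rightarrow> bool" where
  "fundamental_sequences \<phi> \<longleftrightarrow>
    (\<forall>\<xi><omega1. is_limit \<xi> \<longrightarrow>
      (\<forall>n\<ge>1. \<phi> \<xi> n < \<xi>) \<and>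
      (\<forall>m\<ge>1. \<forall>n\<ge>m. \<phi> \<xi> m \<le> \<phi> \<xi> n) \<and>
      (\<forall>\<eta><\<xi>. \<exists>n\<ge>1. \<eta> < \<phi> \<xi> n))"

text \<open>
  On finite sets \<open>E\<close>, \<open>F\<close> of positive integers this is \<open>max E < min F\<close> with the conventions
  \<open>max \<emptyset> = 0\<close> and \<open>min \<emptyset> = \<infinity>\<close>.
\<close>

definition set_before :: "nat set \<Rightarrow> nat set \<Rightarrow> bool" where
  "set_before E F \<longleftrightarrow> (\<forall>m\<in>E. \<forall>n\<in>F. m < n)"

inductive_set schreier_rel :: "(ordinal \<Rightarrow> nat \<Rightarrow> ordinal) \<Rightarrow> (ordinal \<times> nat set) set"
  for \<phi> :: "ordinal \<Rightarrow> nat \<Rightarrow> ordinal"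
where
  zero_empty: "(0, {}) \<in> schreier_rel \<phi>"
| zero_singleton: "n \<ge> 1 \<Longrightarrow> (0, {n}) \<in> schreier_rel \<phi>"
| succ_empty: "(ord_succ \<xi>, {}) \<in> schreier_rel \<phi>"
| succ_union: "\<lbrakk>n \<ge> 1; \<And>i. i \<in> {1..n} \<Longrightarrow> E i \<noteq> {}; \<And>i. i \<in> {1..n} \<Longrightarrow> (\<xi>, E i) \<in> schreier_rel \<phi>;
    \<And>i. i \<in> {1..<n} \<Longrightarrow> set_before (E i) (E (Suc i)); n \<le> Min (E 1)\<rbrakk>
    \<Longrightarrow> (ord_succ \<xi>, \<Union>i\<in>{1..n}. E i) \<in> schreier_rel \<phi>"
| limit: "\<lbrakk>is_limit \<xi>; n \<ge> 1; \<And>m. m \<in> E \<Longrightarrow> n \<le> m; (\<phi> \<xi> n, E) \<in> schreier_rel \<phi>\<rbrakk>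
    \<Longrightarrow> (\<xi>, E) \<in> schreier_rel \<phi>"

definition schreier :: "(ordinal \<Rightarrow> nat \<Rightarrow> ordinal) \<Rightarrow> ordinal \<Rightarrow> nat set set" where
  "schreier \<phi> \<xi> = {E. (\<xi>, E) \<in> schreier_rel \<phi>}"

lemma schreier_zero: "schreier \<phi> 0 = {{}} \<union> {{n} | n. n \<ge> 1}"
  unfolding schreier_def
proof (intro set_eqI iffI)
  fix E assume "E \<in> {E. (0, E) \<in> schreier_rel \<phi>}"
  then have "(0, E) \<in> schreier_rel \<phi>" by simp
  then show "E \<in> {{}} \<union> {{n} | n. n \<ge> 1}"
    by cases (use ord_succ_neq_zero not_is_limit_zero in \<open>fastforce+\<close>)
qed (auto intro: schreier_rel.zero_empty schreier_rel.zero_singleton)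

lemma schreier_succ:
  "schreier \<phi> (ord_succ \<xi>) = {{}} \<union>
    {\<Union>i\<in>{1..n}. E i | n E. n \<ge> 1 \<and> (\<forall>i\<in>{1..n}. E i \<noteq> {} \<and> E i \<in> schreier \<phi> \<xi>) \<and>
      (\<forall>i\<in>{1..<n}. set_before (E i) (E (Suc i))) \<and> n \<le> Min (E 1)}" (is "?L = ?R")
proof
  show "?R \<subseteq> ?L"
  proof
    fix F assume "F \<in> ?R"
    then consider "F = {}"
      | n E where "F = (\<Union>i\<in>{1..n}. E i)" "n \<ge> 1"
        "\<forall>i\<in>{1..n}. E i \<noteq> {} \<and> E i \<in> schreier \<phi> \<xi>"
        "\<forall>i\<in>{1..<n}. set_before (E i) (E (Suc i))" "n \<le> Min (E 1)"
      by blast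
    then show "F \<in> ?L"
    proof cases
      case 1
      then show ?thesis by (simp add: schreier_def schreier_rel.succ_empty)
    next
      case 2
      then have "(ord_succ \<xi>, \<Union>i\<in>{1..n}. E i) \<in> schreier_rel \<phi>"
        by (intro schreier_rel.succ_union) (simp_all add: schreier_def)
      with 2(1) show ?thesis by (simp add: schreier_def)
    qed
  qed
  show "?L \<subseteq> ?R"
  proof
    fix F assume "F \<in> ?L"
    then have "(ord_succ \<xi>, F) \<in> schreier_rel \<phi>" by (simp add: schreier_def)
    then show "F \<in> ?R"
    proof cases
      case (succ_union n E \<eta>)
      then have "F = (\<Union>i\<in>{1..n}. E i) \<and> n \<ge> 1 \<and>
          (\<forall>i\<in>{1..n}. E i \<noteq> {} \<and> E i \<in> schreier \<phi> \<xi>) \<and>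
          (\<forall>i\<in>{1..<n}. set_before (E i) (E (Suc i))) \<and> n \<le> Min (E 1)"
        by (simp add: schreier_def)
      then show ?thesis by blast
    qed simp_all
  qed
qed

lemma schreier_limit:
  assumes "is_limit \<xi>"
  shows "schreier \<phi> \<xi> = {E. \<exists>n\<ge>1. (\<forall>m\<in>E. n \<le> m) \<and> E \<in> schreier \<phi> (\<phi> \<xi> n)}"
proof (intro set_eqI iffI)
  fix E assume "E \<in> schreier \<phi> \<xi>"
  then have "(\<xi>, E) \<in> schreier_rel \<phi>" by (simp add: schreier_def)
  then show "E \<in> {E. \<exists>n\<ge>1. (\<forall>m\<in>E. n \<le> m) \<and> E \<in> schreier \<phi> (\<phi> \<xi> n)}"
    by cases (use assms in \<open>auto simp: schreier_def\<close>)
qed (use assms in \<open>auto simp: schreier_def intro: schreier_rel.limit\<close>)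

section \<open>Banach spaces over the real and complex numbers\<close>

text \<open>
  A real Banach space is a type of class \<open>banach\<close>. A complex Banach space is a real one with a
  compatible complex scalar multiplication. To treat both cases at once, the notions below take
  the scalar multiplication as a parameter.
\<close>

class complex_banach = banach +
  fixes scaleC :: "complex \<Rightarrow> 'a \<Rightarrow> 'a"  (infixr "*\<^sub>C" 75)
  assumes scaleC_add_right: "c *\<^sub>C (x + y) = c *\<^sub>C x + c *\<^sub>C y"
    and scaleC_add_left: "(c + d) *\<^sub>C x = c *\<^sub>C x + d *\<^sub>C x"
    and scaleC_scaleC: "c *\<^sub>C d *\<^sub>C x = (c * d) *\<^sub>C x"
    and scaleC_of_real: "complex_of_real r *\<^sub>C x = r *\<^sub>R x"
    and norm_scaleC: "norm (c *\<^sub>C x) = norm c * norm x"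

instantiation complex :: complex_banach
begin

definition scaleC_complex :: "complex \<Rightarrow> complex \<Rightarrow> complex" where
  "scaleC_complex c x = c * x"

instance
  by standard (simp_all add: scaleC_complex_def algebra_simps norm_mult scaleR_conv_of_real)

end

definition dual_space :: "('k::real_normed_field \<Rightarrow> 'a::banach \<Rightarrow> 'a) \<Rightarrow> ('a \<Rightarrow> 'k) set" where
  "dual_space smul = {f. bounded_linear f \<and> (\<forall>c x. f (smul c x) = c * f x)}"

definition weak_topology :: "('k::real_normed_field \<Rightarrow> 'a::banach \<Rightarrow> 'a) \<Rightarrow> 'a topology" where
  "weak_topology smul = topology_generated_by {f -` U | f U. f \<in> dual_space smul \<and> open U}"

definition weakly_convergent ::
  "('k::real_normed_field \<Rightarrow> 'a::banach \<Rightarrow> 'a) \<Rightarrow> (nat \<Rightarrow> 'a) \<Rightarrow> 'a \<Rightarrow> bool" where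
  "weakly_convergent smul x l \<longleftrightarrow> limitin (weak_topology smul) x l sequentially"

lemma topspace_weak_topology [simp]: "topspace (weak_topology smul) = UNIV"
proof -
  have "(\<lambda>_. 0) \<in> dual_space smul"
    by (simp add: dual_space_def)
  then have "(\<lambda>_. 0) -` UNIV \<in> {f -` U | f U. f \<in> dual_space smul \<and> open U}"
    by blast
  then show ?thesis
    unfolding weak_topology_def topology_generated_by_topspace by auto
qed

section \<open>Weak convergence and weak compactness of order \<open>\<xi>\<close>\<close>

text \<open>
  Sequences are indexed by \<open>n \<ge> 1\<close>: the term \<open>x 0\<close> of \<open>x :: nat \<Rightarrow> 'a\<close> is irrelevant throughout.
  For strictly increasing \<open>r\<close>, the indices \<open>r n\<close> with \<open>n \<ge> 1\<close> are again positive.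
\<close>

definition l1_spreading_model ::
  "('k::real_normed_field \<Rightarrow> 'a::banach \<Rightarrow> 'a) \<Rightarrow> (ordinal \<Rightarrow> nat \<Rightarrow> ordinal) \<Rightarrow> ordinal \<Rightarrow>
    (nat \<Rightarrow> 'a) \<Rightarrow> bool" where
  "l1_spreading_model smul \<phi> \<xi> x \<longleftrightarrow>
    0 < Inf {norm (\<Sum>n\<in>E. smul (a n) (x n)) | E a. E \<in> schreier \<phi> \<xi> \<and> (\<Sum>n\<in>E. norm (a n)) = 1}"

definition xi_weakly_convergent ::
  "('k::real_normed_field \<Rightarrow> 'a::banach \<Rightarrow> 'a) \<Rightarrow> (ordinal \<Rightarrow> nat \<Rightarrow> ordinal) \<Rightarrow> ordinal \<Rightarrow>
    (nat \<Rightarrow> 'a) \<Rightarrow> 'a \<Rightarrow> bool" where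
  "xi_weakly_convergent smul \<phi> \<xi> x l \<longleftrightarrow>
    (if \<xi> = 0 then x \<longlonglongrightarrow> l
     else if \<xi> < omega1 then weakly_convergent smul x l \<and>
       (\<forall>r. strict_mono r \<longrightarrow> \<not> l1_spreading_model smul \<phi> \<xi> (\<lambda>n. x (r n) - l))
     else weakly_convergent smul x l)"

definition xi_weakly_precompact ::
  "('k::real_normed_field \<Rightarrow> 'a::banach \<Rightarrow> 'a) \<Rightarrow> (ordinal \<Rightarrow> nat \<Rightarrow> ordinal) \<Rightarrow> ordinal \<Rightarrow>
    'a set \<Rightarrow> bool" where
  "xi_weakly_precompact smul \<phi> \<xi> K \<longleftrightarrow>
    (\<forall>x :: nat \<Rightarrow> 'a. (\<forall>n\<ge>1. x n \<in> K) \<longrightarrow>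
      (\<exists>r l. strict_mono r \<and> xi_weakly_convergent smul \<phi> \<xi> (x \<circ> r) l))"

definition xi_weakly_compact ::
  "('k::real_normed_field \<Rightarrow> 'a::banach \<Rightarrow> 'a) \<Rightarrow> (ordinal \<Rightarrow> nat \<Rightarrow> ordinal) \<Rightarrow> ordinal \<Rightarrow>
    'a set \<Rightarrow> bool" where
  "xi_weakly_compact smul \<phi> \<xi> K \<longleftrightarrow>
    (\<forall>x :: nat \<Rightarrow> 'a. (\<forall>n\<ge>1. x n \<in> K) \<longrightarrow>
      (\<exists>r. \<exists>l\<in>K. strict_mono r \<and> xi_weakly_convergent smul \<phi> \<xi> (x \<circ> r) l))"

end

theory Submission
  imports Defs
begin

text \<open>
  One direction is immediate, since \<open>K\<close> lies in its weak closure. For the other one, a sequence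
  in the weak closure has to be compared with sequences in \<open>K\<close>, the only ones about which
  something is assumed.

  If every sequence in \<open>K\<close> has a weakly convergent subsequence, then each point of
  the weak closure is the weak limit of a sequence in \<open>K\<close>
  (\<open>weak_closure_point_is_sequential_limit\<close>), and the weak closure is weakly sequentially compact
  (\<open>weak_closure_sequentially_precompact\<close>). Both are proved as in Whitley's treatment of the
  Eberlein--Smulian theorem: inside a separable subspace, countably many functionals separate
  points, and a sequence in \<open>K\<close> can be chosen that imitates the given one on these functionals. This
  settles \<open>\<xi> = \<omega>\<^sub>1\<close>; for \<open>\<xi> = 0\<close> the points of the weak closure are norm limits of points of \<open>K\<close> and
  an approximation in norm is enough.

  Let \<open>0 < \<xi> < \<omega>\<^sub>1\<close> and suppose that a sequence in the weak closure
  converges weakly to \<open>l\<close>, but not \<open>\<xi>\<close>-weakly. A subsequence \<open>X\<^sub>n\<close> then makes \<open>z\<^sub>n = X\<^sub>n - l\<close> an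
  \<open>\<ell>\<^sub>1\<^sup>\<xi>\<close>-spreading model. Each \<open>X\<^sub>n\<close> is the weak limit of a sequence \<open>y\<^sub>n\<^sub>k\<close> in \<open>K\<close>; the point is to
  pick one term from each of infinitely many of these sequences such that the lower estimate
  survives (\<open>diagonal_spreading_model\<close>). Weak approximation does not control the norms of linear
  combinations of unbounded length, so the estimate is moved to functionals. By Hahn--Banach the lower
  estimate on \<open>E\<close> gives a functional in the dual ball that equals the constant \<open>c\<close> at every \<open>z\<^sub>n\<close>,
  \<open>n \<in> E\<close>. Conversely, a lower estimate for \<open>u\<^sub>j = y\<^sub>n\<^sub>k - l\<close> follows from functionals that are
  nearly \<open>c\<close> at \<open>u\<^sub>j\<close> for \<open>j\<close> in a prescribed subset \<open>F\<close> of \<open>E\<close> and nearly \<open>0\<close> for \<open>j\<close> in \<open>E - F\<close>: one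
  takes for \<open>F\<close> a subset on which the coefficients add up without much cancellation.

  Functionals of the second kind are obtained from those of the first kind by a Ramsey argument in
  the style of Elton's near unconditionality theorem
  (\<open>functionals_nearly_supported_on_pattern\<close>). If a weakly null sequence \<open>v\<^sub>k\<close> could never be made
  small without changing the values of the functional at the \<open>z\<^sub>n\<close>, then, after thinning out the
  indices, arbitrarily many of the \<open>v\<^sub>k\<close> would be large at one and the same functional, and weak*
  compactness of the dual ball would give a functional that is large at infinitely many \<open>v\<^sub>k\<close>
  (\<open>functional_values_can_be_made_small\<close>). Applied to \<open>z\<^sub>n\<close> and to \<open>y\<^sub>n\<^sub>k - X\<^sub>n\<close> at each stage of a
  fusion, this makes all the unwanted values small.

  The diagonal sequence lies in \<open>K\<close>, so it has a \<open>\<xi>\<close>-weakly convergent subsequence. Its limit must be \<open>l\<close>,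
  because the arrays \<open>y\<^sub>n\<^sub>k\<close> are chosen so that weak limits of diagonal sequences are determined
  (\<open>diagonal_sequences_same_limit\<close>), and this contradicts the spreading model just found.

  Real and complex scalars are treated simultaneously in a locale that collects the few facts
  about the scalars that enter the argument.
\<close>

section \<open>Subsets that avoid or block a family of finite sets\<close>

text \<open>
  The bookkeeping of a fusion argument: finitely many choices \<open>J\<close> have been made and future choices
  are restricted to an infinite reservoir \<open>N\<close>, which shrinks and moves to the right. The invariant
  relates the two; each \<open>p\<close> may carry more data than its position.
\<close>

lemma fusion_sequence:
  fixes pos :: "'p \<Rightarrow> nat" and Inv :: "'p set \<Rightarrow> nat set \<Rightarrow> bool"
  assumes init: "Inv {} N0"
    and step: "\<And>J N. finite J \<Longrightarrow> Inv J N \<Longrightarrow>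
      \<exists>p N'. pos p \<in> N \<and> N' \<subseteq> N \<inter> {pos p<..} \<and> Inv (insert p J) N'"
  obtains q :: "nat \<Rightarrow> 'p" and N where "strict_mono (\<lambda>t. pos (q t))" "\<And>t. Inv (q ` {..<t}) (N t)"
proof -
  define ok where "ok t s \<longleftrightarrow> finite (fst s) \<and> Inv (fst s) (snd s) \<and> (t = 0 \<longrightarrow> fst s = {})"
    for t :: nat and s
  define next_state where "next_state s s' \<longleftrightarrow> (\<exists>p. pos p \<in> snd s \<and> snd s' \<subseteq> snd s \<inter> {pos p<..} \<and>
      fst s' = insert p (fst s))" for s s'
  have "\<exists>f. \<forall>t. ok t (f t) \<and> next_state (f t) (f (Suc t))"
  proof (rule dependent_nat_choice)
    show "\<exists>s. ok 0 s"
      using init by (intro exI[of _ "({}, N0)"]) (simp add: ok_def)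
  next
    fix s :: "'p set \<times> nat set" and t :: nat
    assume "ok t s"
    then obtain p N' where "pos p \<in> snd s" "N' \<subseteq> snd s \<inter> {pos p<..}" "Inv (insert p (fst s)) N'" "finite (fst s)"
      using step unfolding ok_def by blast
    then show "\<exists>s'. ok (Suc t) s' \<and> next_state s s'"
      by (intro exI[of _ "(insert p (fst s), N')"]) (auto simp: ok_def next_state_def)
  qed
  then obtain f where f: "\<And>t. ok t (f t)" "\<And>t. next_state (f t) (f (Suc t))" by blast
  define J N where "J t = fst (f t)" and "N t = snd (f t)" for t
  have Inv: "Inv (J t) (N t)" and J0: "J 0 = {}" for t
    using f(1)[of t] f(1)[of 0] by (auto simp: J_def N_def ok_def)
  obtain q where q: "\<And>t. pos (q t) \<in> N t" "\<And>t. N (Suc t) \<subseteq> N t \<inter> {pos (q t)<..}"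
    "\<And>t. J (Suc t) = insert (q t) (J t)"
    using f(2) unfolding next_state_def J_def N_def by metis
  have "J t = q ` {..<t}" for t
    by (induction t) (auto simp: J0 q(3) lessThan_Suc)
  with Inv have "Inv (q ` {..<t}) (N t)" for t by metis
  moreover have "strict_mono (\<lambda>t. pos (q t))"
    using q(1,2) by (intro strict_mono_Suc_iff[THEN iffD2] allI) blast
  ultimately show ?thesis using that by blast
qed

text \<open>
  Combinatorial forcing for a family \<open>P\<close> of finite sets: \<open>M\<close> accepts \<open>s\<close> if every continuation of \<open>s\<close>
  within \<open>M\<close> runs into \<open>P\<close>.
\<close>

definition accepts :: "(nat set \<Rightarrow> bool) \<Rightarrow> nat set \<Rightarrow> nat set \<Rightarrow> bool" where
  "accepts P M s \<longleftrightarrow>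
    (\<forall>L. infinite L \<and> L \<subseteq> M \<and> (\<forall>i\<in>s. \<forall>j\<in>L. i < j) \<longrightarrow> (\<exists>m. P ((s \<union> L) \<inter> {..<m})))"

definition rejects :: "(nat set \<Rightarrow> bool) \<Rightarrow> nat set \<Rightarrow> nat set \<Rightarrow> bool" where
  "rejects P N s \<longleftrightarrow> (\<forall>M. infinite M \<and> M \<subseteq> N \<longrightarrow> \<not> accepts P M s)"

lemma rejects_subset: "rejects P N s \<Longrightarrow> N' \<subseteq> N \<Longrightarrow> rejects P N' s"
  unfolding rejects_def by blast

text \<open>
  Otherwise one could choose \<open>n\<^sub>0 < n\<^sub>1 < \<dots>\<close> with shrinking reservoirs such that some \<open>insert n\<^sub>t s\<^sub>t\<close> with
  \<open>s\<^sub>t \<in> S\<close> is accepted at every stage. Some \<open>s \<in> S\<close> occurs infinitely often, and the corresponding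
  \<open>n\<^sub>t\<close> form a subset of \<open>N\<close> that accepts \<open>s\<close>: a continuation of \<open>s\<close> in this set starts with
  one of the \<open>n\<^sub>t\<close> and continues in the reservoir of its stage.
\<close>

lemma rejects_extend:
  assumes N: "infinite N" and S: "finite S" and rej: "\<And>s. s \<in> S \<Longrightarrow> rejects P N s"
  shows "\<exists>n\<in>N. \<exists>M. infinite M \<and> M \<subseteq> N \<inter> {n<..} \<and> (\<forall>s\<in>S. rejects P M (insert n s))"
proof (rule ccontr)
  assume "\<not> ?thesis"
  then have acc: "\<exists>s\<in>S. \<exists>M'. infinite M' \<and> M' \<subseteq> M \<and> accepts P M' (insert n s)"
    if "n \<in> N" "infinite M" "M \<subseteq> N \<inter> {n<..}" for n M
    using that unfolding rejects_def by metis
  define good where "good x \<longleftrightarrow> fst x \<in> N \<and> fst (snd x) \<in> S \<and> infinite (snd (snd x)) \<and>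
      snd (snd x) \<subseteq> N \<inter> {fst x<..} \<and> accepts P (snd (snd x)) (insert (fst x) (fst (snd x)))" for x
  define later where "later x y \<longleftrightarrow> fst y \<in> snd (snd x) \<and> snd (snd y) \<subseteq> snd (snd x)"
    for x y :: "nat \<times> nat set \<times> nat set"
  have ex: "\<exists>y. fst y \<in> M \<and> snd (snd y) \<subseteq> M \<and> good y" if M: "infinite M" "M \<subseteq> N" for M
  proof -
    obtain n where n: "n \<in> M" using infinite_imp_nonempty[OF M(1)] by blast
    have "M \<subseteq> (M \<inter> {n<..}) \<union> {..n}" by auto
    then have "infinite (M \<inter> {n<..})"
      using M(1) finite_subset by blast
    then obtain s M' where M': "s \<in> S" "infinite M'" "M' \<subseteq> M \<inter> {n<..}" "accepts P M' (insert n s)"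
      using acc[of n "M \<inter> {n<..}"] n M by blast
    have "good (n, s, M')" using M' n M(2) by (auto simp: good_def)
    then show ?thesis using n M'(3) by (intro exI[of _ "(n, s, M')"]) simp
  qed
  have "\<exists>f. \<forall>t::nat. good (f t) \<and> later (f t) (f (Suc t))"
  proof (rule dependent_nat_choice)
    show "\<exists>x. good x" using ex[OF N] by blast
  next
    fix x and t :: nat
    assume "good x"
    then have "infinite (snd (snd x))" "snd (snd x) \<subseteq> N" by (simp_all add: good_def)
    from ex[OF this] show "\<exists>y. good y \<and> later x y" unfolding later_def by blast
  qed
  then obtain f where f: "\<And>t::nat. good (f t)" "\<And>t. later (f t) (f (Suc t))" by blast
  define n s M where "n t = fst (f t)" and "s t = fst (snd (f t))" and "M t = snd (snd (f t))" for t
  have g: "n t \<in> N" "s t \<in> S" "M t \<subseteq> {n t<..}" "accepts P (M t) (insert (n t) (s t))" for t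
    using f(1)[of t] by (simp_all add: good_def n_def s_def M_def)
  have n: "n (Suc t) \<in> M t" and Mdec: "M (Suc t) \<subseteq> M t" for t
    using f(2)[of t] by (simp_all add: later_def n_def M_def)
  have Mmono: "M t' \<subseteq> M t" if "t \<le> t'" for t t'
    using Mdec that by (rule lift_Suc_antimono_le)
  have nM: "n t' \<in> M t" if "t < t'" for t t'
    using n[of "t' - 1"] Mmono[of t "t' - 1"] that by (cases t') auto
  have mono: "strict_mono n"
    using nM g(3) by (intro strict_monoI) blast
  obtain t0 where t0: "infinite {t. s t = s t0}"
    using pigeonhole_infinite[of "UNIV :: nat set" s] finite_subset[OF _ S, of "range s"] g(2) by auto
  \<comment> \<open>This set accepts \<open>s t0\<close>, although \<open>N\<close> rejects it.\<close>
  define L where "L = n ` {t. s t = s t0}"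
  have "infinite L"
    unfolding L_def using t0 inj_on_subset[OF strict_mono_imp_inj_on[OF mono] subset_UNIV] by (metis finite_imageD)
  moreover have "L \<subseteq> N" unfolding L_def using g(1) by blast
  moreover have "accepts P L (s t0)"
    unfolding accepts_def
  proof safe
    fix L' assume L': "infinite L'" "L' \<subseteq> L" "\<forall>i\<in>s t0. \<forall>j\<in>L'. i < j"
    then obtain x where "x \<in> L'" using infinite_imp_nonempty by blast
    define a where "a = (LEAST x. x \<in> L')"
    have a: "a \<in> L'" "\<And>x. x \<in> L' \<Longrightarrow> a \<le> x"
      unfolding a_def using \<open>x \<in> L'\<close> by (auto intro: LeastI Least_le)
    from a(1) L'(2) obtain t where t: "a = n t" "s t = s t0" unfolding L_def by auto
    have "L' - {a} \<subseteq> M t"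
    proof
      fix x assume x: "x \<in> L' - {a}"
      then obtain t' where t': "x = n t'" using L'(2) unfolding L_def by auto
      have "n t < n t'" using a(2)[of x] x t(1) t' by auto
      then have "t < t'" using mono by (simp add: strict_mono_less)
      then show "x \<in> M t" using nM t' by simp
    qed
    moreover have "infinite (L' - {a})" using L'(1) by simp
    moreover have "\<forall>i\<in>insert (n t) (s t). \<forall>j\<in>L' - {a}. i < j"
      using L'(3) a(2) t by (auto simp: order_le_neq_trans)
    ultimately obtain m where "P ((insert (n t) (s t) \<union> (L' - {a})) \<inter> {..<m})"
      using g(4)[of t] unfolding accepts_def by blast
    moreover have "insert (n t) (s t) \<union> (L' - {a}) = s t0 \<union> L'" using a(1) t by auto
    ultimately show "\<exists>m. P ((s t0 \<union> L') \<inter> {..<m})" by auto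
  qed
  ultimately show False using rej[OF g(2)] unfolding rejects_def by blast
qed

text \<open>
  Galvin's lemma. If no subset of \<open>N\<close> accepts the empty set, then rejection can be kept alive along a
  fusion for all finite subsets of the chosen set, and a rejected set is not in \<open>P\<close>.
\<close>

lemma infinite_subset_avoids_or_barrier:
  fixes P :: "nat set \<Rightarrow> bool"
  assumes N: "infinite N"
  obtains M where "infinite M" "M \<subseteq> N"
    "(\<forall>H. finite H \<and> H \<subseteq> M \<longrightarrow> \<not> P H) \<or>
     (\<forall>L. infinite L \<and> L \<subseteq> M \<longrightarrow> (\<exists>m. P (L \<inter> {..<m})))"
proof (cases "rejects P N {}")
  case False
  then obtain M where "infinite M" "M \<subseteq> N" "accepts P M {}"
    unfolding rejects_def by blast
  then show ?thesis using that[of M] by (simp add: accepts_def)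
next
  case True
  define Inv where "Inv J M \<longleftrightarrow> infinite M \<and> M \<subseteq> N \<and> J \<subseteq> N \<and> (\<forall>s\<subseteq>J. rejects P M s)" for J M
  have step: "\<exists>p M'. id p \<in> M \<and> M' \<subseteq> M \<inter> {id p<..} \<and> Inv (insert p J) M'"
    if J: "finite J" and inv: "Inv J M" for J M
  proof -
    have M: "infinite M" "M \<subseteq> N" "J \<subseteq> N" "\<And>s. s \<in> Pow J \<Longrightarrow> rejects P M s"
      using inv by (auto simp: Inv_def)
    obtain n M' where n: "n \<in> M" "infinite M'" "M' \<subseteq> M \<inter> {n<..}"
      "\<forall>s\<in>Pow J. rejects P M' (insert n s)"
      using rejects_extend[of M "Pow J" P] M J by auto
    have "rejects P M' s" if "s \<subseteq> insert n J" for s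
    proof (cases "n \<in> s")
      case True
      then have "s = insert n (s - {n})" "s - {n} \<in> Pow J" using that by auto
      then show ?thesis using n(4) by metis
    next
      case False
      then have "s \<in> Pow J" using that by auto
      then show ?thesis using rejects_subset[OF M(4)] n(3) by simp
    qed
    moreover have "M' \<subseteq> N" "insert n J \<subseteq> N" using n(1,3) M(2,3) by auto
    ultimately have "Inv (insert n J) M'"
      using n(2) by (simp add: Inv_def)
    then show ?thesis using n by (intro exI[of _ n] exI[of _ M']) simp
  qed
  have "Inv {} N" using N True by (simp add: Inv_def)
  from fusion_sequence[of Inv N id, OF this step]
  obtain q :: "nat \<Rightarrow> nat" and N' where
    q: "strict_mono (\<lambda>t. id (q t))" "\<And>t. Inv (q ` {..<t}) (N' t)"
    by blast
  have qN: "q t \<in> N" for t using q(2)[of "Suc t"] by (auto simp: Inv_def)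
  have inj: "inj q" using q(1) strict_mono_imp_inj_on by simp
  \<comment> \<open>If \<open>H\<close> were in the family, every reservoir to the right of \<open>H\<close> would accept \<open>H\<close>.\<close>
  have "\<not> P H" if H: "finite H" "H \<subseteq> range q" for H
  proof
    assume "P H"
    obtain T where T: "finite T" "H = q ` T" using H by (meson finite_subset_image)
    obtain t where "T \<subseteq> {..<t}" using T(1) by (metis finite_nat_iff_bounded)
    then have "H \<subseteq> q ` {..<t}" using T(2) by auto
    then have "rejects P (N' t) H" "infinite (N' t)" using q(2)[of t] by (simp_all add: Inv_def)
    moreover have "accepts P (N' t) H"
      unfolding accepts_def
    proof safe
      fix L assume L: "infinite L" "\<forall>i\<in>H. \<forall>j\<in>L. i < j"
      then obtain x where "x \<in> L" using infinite_imp_nonempty by blast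
      define a where "a = (LEAST x. x \<in> L)"
      have "a \<in> L" "\<And>x. x \<in> L \<Longrightarrow> a \<le> x"
        unfolding a_def using \<open>x \<in> L\<close> by (auto intro: LeastI Least_le)
      then have "\<And>x. x \<in> L \<Longrightarrow> \<not> x < a" "\<And>x. x \<in> H \<Longrightarrow> x < a"
        using L(2) by (auto simp: not_less)
      \<comment> \<open>Cutting just before the first element of \<open>L\<close> returns \<open>H\<close> itself.\<close>
      then have "(H \<union> L) \<inter> {..<a} = H" by auto
      then show "\<exists>m. P ((H \<union> L) \<inter> {..<m})" using \<open>P H\<close> by (intro exI[of _ a]) simp
    qed
    ultimately show False by (simp add: rejects_def)
  qed
  then show ?thesis
    using that[of "range q"] qN range_inj_infinite[OF inj] by (simp add: image_subset_iff)
qed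

lemma infinite_subset_avoids_or_barrier_finite:
  fixes P :: "'c \<Rightarrow> nat set \<Rightarrow> bool"
  assumes I: "finite I" and N: "infinite N"
  obtains M where "infinite M" "M \<subseteq> N"
    "(\<forall>c\<in>I. \<forall>H. finite H \<and> H \<subseteq> M \<longrightarrow> \<not> P c H) \<or>
     (\<exists>c\<in>I. \<forall>L. infinite L \<and> L \<subseteq> M \<longrightarrow> (\<exists>m. P c (L \<inter> {..<m})))"
proof -
  have "\<exists>M. infinite M \<and> M \<subseteq> N \<and>
    ((\<forall>c\<in>I. \<forall>H. finite H \<and> H \<subseteq> M \<longrightarrow> \<not> P c H) \<or>
     (\<exists>c\<in>I. \<forall>L. infinite L \<and> L \<subseteq> M \<longrightarrow> (\<exists>m. P c (L \<inter> {..<m}))))"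
    using I
  proof (induction I)
    case empty
    then show ?case using N by auto
  next
    case (insert c I)
    then obtain M where M: "infinite M" "M \<subseteq> N"
      "(\<forall>c\<in>I. \<forall>H. finite H \<and> H \<subseteq> M \<longrightarrow> \<not> P c H) \<or>
       (\<exists>c\<in>I. \<forall>L. infinite L \<and> L \<subseteq> M \<longrightarrow> (\<exists>m. P c (L \<inter> {..<m})))" by blast
    obtain M' where M': "infinite M'" "M' \<subseteq> M"
      "(\<forall>H. finite H \<and> H \<subseteq> M' \<longrightarrow> \<not> P c H) \<or>
       (\<forall>L. infinite L \<and> L \<subseteq> M' \<longrightarrow> (\<exists>m. P c (L \<inter> {..<m})))"
      by (rule infinite_subset_avoids_or_barrier[OF M(1), of "P c"])
    have "(\<forall>c\<in>insert c I. \<forall>H. finite H \<and> H \<subseteq> M' \<longrightarrow> \<not> P c H) \<or>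
       (\<exists>c\<in>insert c I. \<forall>L. infinite L \<and> L \<subseteq> M' \<longrightarrow> (\<exists>m. P c (L \<inter> {..<m})))"
      using M(3)
    proof
      assume a: "\<forall>c\<in>I. \<forall>H. finite H \<and> H \<subseteq> M \<longrightarrow> \<not> P c H"
      have "\<not> P c' H" if "c' \<in> I" "finite H" "H \<subseteq> M'" for c' H
        using a that M'(2) by (meson subset_trans)
      with M'(3) show ?thesis by auto
    next
      assume "\<exists>c\<in>I. \<forall>L. infinite L \<and> L \<subseteq> M \<longrightarrow> (\<exists>m. P c (L \<inter> {..<m}))"
      then show ?thesis using M'(2) by (meson insertI2 subset_trans)
    qed
    moreover have "M' \<subseteq> N" using M(2) M'(2) by simp
    ultimately show ?case using M'(1) by (intro exI[of _ M'] conjI)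
  qed
  then show ?thesis using that by (elim exE conjE)
qed

section \<open>The Hahn--Banach theorem for sublinear functionals\<close>

definition sublinear :: "('a::real_vector \<Rightarrow> real) \<Rightarrow> bool" where
  "sublinear p \<longleftrightarrow> (\<forall>x y. p (x + y) \<le> p x + p y) \<and> (\<forall>t>0. \<forall>x. p (t *\<^sub>R x) \<le> t * p x)"

lemma sublinearI:
  assumes "\<And>x y. p (x + y) \<le> p x + p y" "\<And>t x. 0 < t \<Longrightarrow> p (t *\<^sub>R x) \<le> t * p x"
  shows "sublinear p"
  using assms by (simp add: sublinear_def)

context
  fixes p :: "'a::real_vector \<Rightarrow> real"
  assumes p: "sublinear p"
begin

lemma sublinear_add: "p (x + y) \<le> p x + p y"
  and sublinear_scaleR_le: "0 < t \<Longrightarrow> p (t *\<^sub>R x) \<le> t * p x"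
  using p by (simp_all add: sublinear_def)

lemma sublinear_zero: "p 0 = 0"
  using sublinear_scaleR_le[of 2 0] sublinear_scaleR_le[of "1/2" 0] by simp

lemma sublinear_scaleR: "0 \<le> t \<Longrightarrow> p (t *\<^sub>R x) = t * p x"
proof (cases "t = 0")
  case False
  assume "0 \<le> t"
  with False have t: "0 < t" by simp
  have "p ((1 / t) *\<^sub>R (t *\<^sub>R x)) \<le> (1 / t) * p (t *\<^sub>R x)"
    using sublinear_scaleR_le[of "1 / t" "t *\<^sub>R x"] t by simp
  then have "t * p x \<le> p (t *\<^sub>R x)" using t by (simp add: field_simps)
  then show ?thesis using sublinear_scaleR_le[OF t, of x] by simp
qed (simp add: sublinear_zero)

lemma sublinear_minus: "- p (- x) \<le> p x"
  using sublinear_add[of x "- x"] sublinear_zero by simp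

end

text \<open>
  The sublinear functional that decides the value at \<open>x\<^sub>0\<close>: it lies below \<open>p\<close>, and every linear functional
  below it has the largest possible value \<open>p x\<^sub>0\<close> at \<open>x\<^sub>0\<close>.
\<close>

definition tilt :: "('a::real_vector \<Rightarrow> real) \<Rightarrow> 'a \<Rightarrow> 'a \<Rightarrow> real" where
  "tilt p x\<^sub>0 x = (INF t\<in>{0..}. p (x + t *\<^sub>R x\<^sub>0) - t * p x\<^sub>0)"

context
  fixes p :: "'a::real_vector \<Rightarrow> real" and x\<^sub>0 :: 'a
  assumes p: "sublinear p"
begin

lemma tilt_le: "0 \<le> t \<Longrightarrow> tilt p x\<^sub>0 x \<le> p (x + t *\<^sub>R x\<^sub>0) - t * p x\<^sub>0"
proof -
  assume t: "0 \<le> t"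
  have "- p (- x) \<le> p (x + s *\<^sub>R x\<^sub>0) - s * p x\<^sub>0" if "0 \<le> s" for s
    using sublinear_add[OF p, of "x + s *\<^sub>R x\<^sub>0" "- x"] sublinear_scaleR[OF p that, of x\<^sub>0] by simp
  then have "bdd_below ((\<lambda>s. p (x + s *\<^sub>R x\<^sub>0) - s * p x\<^sub>0) ` {0..})"
    by (intro bdd_belowI2) auto
  then show ?thesis unfolding tilt_def using t by (intro cINF_lower) auto
qed

lemma tilt_greatest:
  "(\<And>t. 0 \<le> t \<Longrightarrow> c \<le> p (x + t *\<^sub>R x\<^sub>0) - t * p x\<^sub>0) \<Longrightarrow> c \<le> tilt p x\<^sub>0 x"
  unfolding tilt_def by (intro cINF_greatest) auto

lemma tilt_le_self: "tilt p x\<^sub>0 x \<le> p x"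
  using tilt_le[of 0 x] by simp

lemma tilt_minus: "tilt p x\<^sub>0 (- x\<^sub>0) \<le> - p x\<^sub>0"
  using tilt_le[of 1 "- x\<^sub>0"] sublinear_zero[OF p] by simp

lemma sublinear_tilt: "sublinear (tilt p x\<^sub>0)"
proof (rule sublinearI)
  fix x y
  have "tilt p x\<^sub>0 (x + y) - (p (y + s *\<^sub>R x\<^sub>0) - s * p x\<^sub>0) \<le> p (x + t *\<^sub>R x\<^sub>0) - t * p x\<^sub>0"
    if "0 \<le> s" "0 \<le> t" for s t
    using tilt_le[of "s + t" "x + y"] that sublinear_add[OF p, of "x + t *\<^sub>R x\<^sub>0" "y + s *\<^sub>R x\<^sub>0"]
    by (simp add: algebra_simps)
  then have "tilt p x\<^sub>0 (x + y) - (p (y + s *\<^sub>R x\<^sub>0) - s * p x\<^sub>0) \<le> tilt p x\<^sub>0 x" if "0 \<le> s" for s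
    using that by (intro tilt_greatest) auto
  then have "tilt p x\<^sub>0 (x + y) - tilt p x\<^sub>0 x \<le> tilt p x\<^sub>0 y"
    by (intro tilt_greatest) (simp add: algebra_simps)
  then show "tilt p x\<^sub>0 (x + y) \<le> tilt p x\<^sub>0 x + tilt p x\<^sub>0 y" by simp
next
  fix s :: real and x assume s: "0 < s"
  have "tilt p x\<^sub>0 (s *\<^sub>R x) / s \<le> p (x + t *\<^sub>R x\<^sub>0) - t * p x\<^sub>0" if "0 \<le> t" for t
  proof -
    have "tilt p x\<^sub>0 (s *\<^sub>R x) \<le> p (s *\<^sub>R (x + t *\<^sub>R x\<^sub>0)) - s * t * p x\<^sub>0"
      using tilt_le[of "s * t" "s *\<^sub>R x"] s that by (simp add: scaleR_add_right)
    also have "\<dots> = s * (p (x + t *\<^sub>R x\<^sub>0) - t * p x\<^sub>0)"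
      using sublinear_scaleR[OF p, of s "x + t *\<^sub>R x\<^sub>0"] s by (simp add: right_diff_distrib)
    finally show ?thesis using s by (simp add: field_simps)
  qed
  then have "tilt p x\<^sub>0 (s *\<^sub>R x) / s \<le> tilt p x\<^sub>0 x" by (rule tilt_greatest)
  then show "tilt p x\<^sub>0 (s *\<^sub>R x) \<le> s * tilt p x\<^sub>0 x" using s by (simp add: field_simps)
qed

end

text \<open>
  Minimality forces \<open>tilt q x = q\<close> for every \<open>x\<close>, which says that \<open>q\<close> is odd; an odd sublinear
  functional is linear.
\<close>

lemma linear_if_minimal_sublinear:
  assumes q: "sublinear q" and min: "\<And>q'. sublinear q' \<Longrightarrow> (\<And>x. q' x \<le> q x) \<Longrightarrow> q' = q"
  shows "linear q"
proof -
  have neg: "q (- x) = - q x" for x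
  proof -
    have "tilt q x = q" by (rule min[OF sublinear_tilt[OF q] tilt_le_self[OF q]])
    then show ?thesis using tilt_minus[OF q, of x] sublinear_minus[OF q, of "- x"] by simp
  qed
  show ?thesis
  proof (rule linearI)
    fix x y
    show "q (x + y) = q x + q y"
      using sublinear_add[OF q, of x y] sublinear_add[OF q, of "- x" "- y"] neg[of x] neg[of y] neg[of "x + y"]
      by simp
  next
    fix t x
    show "q (t *\<^sub>R x) = t *\<^sub>R q x"
    proof (cases "0 \<le> t")
      case False
      then have "q ((- t) *\<^sub>R x) = (- t) * q x" using sublinear_scaleR[OF q, of "- t"] by simp
      then show ?thesis using neg[of "t *\<^sub>R x"] by simp
    qed (simp add: sublinear_scaleR[OF q])
  qed
qed

lemma sublinear_INF_chain:
  assumes "C \<noteq> {}" and q: "\<And>q. q \<in> C \<Longrightarrow> sublinear q \<and> (\<forall>x. q x \<le> p x)"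
    and chain: "\<And>q q'. q \<in> C \<Longrightarrow> q' \<in> C \<Longrightarrow> (\<forall>x. q x \<le> q' x) \<or> (\<forall>x. q' x \<le> q x)"
  shows "sublinear (\<lambda>x. INF q\<in>C. q x)" "q \<in> C \<Longrightarrow> (INF q\<in>C. q x) \<le> q x"
proof -
  have lower: "(INF q\<in>C. q x) \<le> q x" if "q \<in> C" for q x
  proof -
    have "- p (- x) \<le> q' x" if "q' \<in> C" for q'
      using q[OF that] sublinear_minus[of q' x] order_trans by (metis neg_le_iff_le)
    then have "bdd_below ((\<lambda>q. q x) ` C)" by (rule bdd_belowI2)
    then show ?thesis using that by (rule cINF_lower)
  qed
  show "q \<in> C \<Longrightarrow> (INF q\<in>C. q x) \<le> q x" by (rule lower)
  show "sublinear (\<lambda>x. INF q\<in>C. q x)"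
  proof (rule sublinearI)
    fix x y
    have "(INF q\<in>C. q (x + y)) \<le> q x + q' y" if C: "q \<in> C" "q' \<in> C" for q q'
    proof (cases "\<forall>x. q x \<le> q' x")
      case True
      then show ?thesis using lower[OF C(1), of "x + y"] q[OF C(1)] sublinear_add[of q x y]
        by (smt (verit))
    next
      case False
      then have "\<forall>x. q' x \<le> q x" using chain[OF C] by blast
      then show ?thesis using lower[OF C(2), of "x + y"] q[OF C(2)] sublinear_add[of q' x y]
        by (smt (verit))
    qed
    then have "(INF q\<in>C. q (x + y)) - q' y \<le> (INF q\<in>C. q x)" if "q' \<in> C" for q'
      using that assms(1) by (intro cINF_greatest) (auto simp: diff_le_eq)
    then have "(INF q\<in>C. q (x + y)) - (INF q\<in>C. q x) \<le> (INF q\<in>C. q y)"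
      using assms(1) by (intro cINF_greatest) (auto simp: algebra_simps)
    then show "(INF q\<in>C. q (x + y)) \<le> (INF q\<in>C. q x) + (INF q\<in>C. q y)" by simp
  next
    fix t :: real and x assume t: "0 < t"
    have "(INF q\<in>C. q (t *\<^sub>R x)) / t \<le> q x" if "q \<in> C" for q
      using lower[OF that, of "t *\<^sub>R x"] q[OF that] sublinear_scaleR[of q t x] t
      by (simp add: field_simps)
    then have "(INF q\<in>C. q (t *\<^sub>R x)) / t \<le> (INF q\<in>C. q x)"
      using assms(1) by (intro cINF_greatest) auto
    then show "(INF q\<in>C. q (t *\<^sub>R x)) \<le> t * (INF q\<in>C. q x)" using t by (simp add: field_simps)
  qed
qed

text \<open>
  Zorn's lemma gives a minimal sublinear functional below \<open>p\<close>. No partially defined functionals are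
  involved: extension problems are encoded in the choice of \<open>p\<close>.
\<close>

lemma hahn_banach:
  assumes p: "sublinear p"
  obtains F where "linear F" "\<And>x. F x \<le> p x"
proof -
  define A where "A = {q. sublinear q \<and> (\<forall>x. q x \<le> p x)}"
  define below where "below q q' \<longleftrightarrow> (\<forall>x. q' x \<le> q x)" for q q' :: "'a \<Rightarrow> real"
  have "\<exists>m\<in>A. \<forall>q\<in>A. below m q \<longrightarrow> q = m"
  proof (rule predicate_Zorn)
    show "partial_order_on A (relation_of below A)"
      by (intro partial_order_on_relation_ofI) (auto simp: below_def fun_eq_iff intro: order_trans antisym)
  next
    fix C assume "C \<in> Chains (relation_of below A)"
    then have C: "C \<subseteq> A" "\<And>q q'. q \<in> C \<Longrightarrow> q' \<in> C \<Longrightarrow> below q q' \<or> below q' q"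
      by (auto simp: Chains_def relation_of_def)
    show "\<exists>u\<in>A. \<forall>q\<in>C. below q u"
    proof (cases "C = {}")
      case True
      then show ?thesis using p by (auto simp: A_def)
    next
      case False
      have sub: "\<And>q. q \<in> C \<Longrightarrow> sublinear q \<and> (\<forall>x. q x \<le> p x)" using C(1) by (auto simp: A_def)
      have ch: "\<And>q q'. q \<in> C \<Longrightarrow> q' \<in> C \<Longrightarrow> (\<forall>x. q x \<le> q' x) \<or> (\<forall>x. q' x \<le> q x)"
        using C(2) by (auto simp: below_def)
      have inf: "sublinear (\<lambda>x. INF q\<in>C. q x)" "\<And>q x. q \<in> C \<Longrightarrow> (INF q\<in>C. q x) \<le> q x"
        using sublinear_INF_chain[of C p] False sub ch by blast+
      obtain q where q: "q \<in> C" using False by blast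
      have "(INF q\<in>C. q x) \<le> p x" for x using inf(2)[OF q, of x] sub[OF q] order_trans by blast
      with inf show ?thesis by (intro bexI[of _ "\<lambda>x. INF q\<in>C. q x"]) (auto simp: A_def below_def)
    qed
  qed
  then obtain m where m: "m \<in> A" "\<And>q. q \<in> A \<Longrightarrow> below m q \<Longrightarrow> q = m" by blast
  have "linear m"
  proof (rule linear_if_minimal_sublinear)
    show "sublinear m" using m(1) by (simp add: A_def)
  next
    fix q assume q: "sublinear q" "\<And>x. q x \<le> m x"
    then have "q \<in> A" using m(1) order_trans by (fastforce simp: A_def)
    then show "q = m" using m(2) q(2) by (simp add: below_def)
  qed
  then show ?thesis using that m(1) by (simp add: A_def)
qed

lemma hahn_banach_at:
  assumes p: "sublinear p"
  obtains F where "linear F" "\<And>x. F x \<le> p x" "F x\<^sub>0 = p x\<^sub>0"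
proof -
  obtain F where F: "linear F" "\<And>x. F x \<le> tilt p x\<^sub>0 x"
    using hahn_banach[OF sublinear_tilt[OF p]] by metis
  have "F x \<le> p x" for x using F(2)[of x] tilt_le_self[OF p, of x\<^sub>0 x] by simp
  moreover have "p x\<^sub>0 \<le> F x\<^sub>0"
    using F(2)[of "- x\<^sub>0"] tilt_minus[OF p, of x\<^sub>0] linear_neg[OF F(1), of x\<^sub>0] by simp
  ultimately show ?thesis using that[OF F(1)] by (meson antisym)
qed

section \<open>Functionals on real and complex Banach spaces\<close>

lemma closure_subspace_diff:
  fixes S :: "'a::real_normed_vector set"
  assumes S: "subspace S" and uv: "u \<in> closure S" "v \<in> closure S"
  shows "u - v \<in> closure S"
proof -
  obtain s t where "\<forall>n. s n \<in> S" "s \<longlonglongrightarrow> u" "\<forall>n. t n \<in> S" "t \<longlonglongrightarrow> v"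
    using uv unfolding closure_sequential by blast
  then have "\<forall>n. s n - t n \<in> S" "(\<lambda>n. s n - t n) \<longlonglongrightarrow> u - v"
    using subspace_diff[OF S] by (auto intro: tendsto_diff)
  then show ?thesis unfolding closure_sequential by (intro exI[of _ "\<lambda>n. s n - t n"]) simp
qed

text \<open>
  What the argument uses of the scalar field \<open>'k\<close>. The map \<open>re\<close> is the real part; real functionals come from
  Hahn--Banach and are converted to scalar-valued ones by \<open>extend_real_functional\<close>. The constant
  in \<open>large_partial_sum\<close> is the one for complex scalars, where a sum is first split by real and
  imaginary part and then by sign.
\<close>

locale banach_scalars =
  fixes smul :: "'k::{real_normed_field,heine_borel} \<Rightarrow> 'a::banach \<Rightarrow> 'a"
    and re :: "'k \<Rightarrow> real"
  assumes linear_smul_left: "linear (\<lambda>c. smul c x)"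
    and linear_re: "linear re"
    and abs_re_le: "\<bar>re c\<bar> \<le> norm c"
    and eq_zero_if_re_mult_nonpos: "(\<And>c. re (c * d) \<le> 0) \<Longrightarrow> d = 0"
    and extend_real_functional: "linear F \<Longrightarrow> (\<And>x. F x \<le> norm x) \<Longrightarrow>
      \<exists>G\<in>dual_space smul. \<forall>x. norm (G x) \<le> norm x \<and> re (G x) = F x"
    and large_partial_sum: "finite (E :: nat set) \<Longrightarrow> \<exists>F\<subseteq>E. (\<Sum>n\<in>E. norm (a n :: 'k)) \<le> 4 * norm (\<Sum>n\<in>F. a n)"
begin

definition dual_ball :: "('a \<Rightarrow> 'k) set" where
  "dual_ball = {f \<in> dual_space smul. \<forall>x. norm (f x) \<le> norm x}"

lemma dual_space_linear:
  assumes "f \<in> dual_space smul"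
  shows "linear f" "f (smul c x) = c * f x"
  using assms by (auto simp: dual_space_def bounded_linear.linear)

lemma dual_ball_dual_space: "f \<in> dual_ball \<Longrightarrow> f \<in> dual_space smul"
  and norm_dual_ball: "f \<in> dual_ball \<Longrightarrow> norm (f x) \<le> norm x"
  by (simp_all add: dual_ball_def)

lemma dual_ball_iff:
  "f \<in> dual_ball \<longleftrightarrow> (\<forall>x y. f (x + y) = f x + f y) \<and> (\<forall>r x. f (r *\<^sub>R x) = r *\<^sub>R f x) \<and>
    (\<forall>c x. f (smul c x) = c * f x) \<and> f \<in> (\<Pi>\<^sub>E x\<in>UNIV. cball 0 (norm x))" (is "_ \<longleftrightarrow> ?R")
proof
  assume f: "f \<in> dual_ball"
  then show ?R
    using dual_space_linear[OF dual_ball_dual_space[OF f]] norm_dual_ball[OF f]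
    by (auto simp: linear_add linear_scale)
next
  assume R: ?R
  then have "norm (f x) \<le> norm x" for x by (auto simp: PiE_iff)
  moreover from this have "bounded_linear f"
    using R by (intro bounded_linear_intro[of _ 1]) auto
  ultimately show "f \<in> dual_ball" using R by (simp add: dual_ball_def dual_space_def)
qed

text \<open>
  The Banach--Alaoglu theorem: in the product topology on functions, the dual ball is a closed
  subset of a product of balls of scalars.
\<close>

lemma compact_dual_ball: "compact dual_ball"
proof -
  have coord: "continuous_on UNIV (\<lambda>f. f x)" for x :: 'a and f :: "'a \<Rightarrow> 'k"
    by (rule continuous_on_product_coordinates)
  have "closed {f :: 'a \<Rightarrow> 'k. (\<forall>x y. f (x + y) = f x + f y) \<and> (\<forall>r x. f (r *\<^sub>R x) = r *\<^sub>R f x) \<and>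
    (\<forall>c x. f (smul c x) = c * f x)}"
    by (intro closed_Collect_conj closed_Collect_all closed_Collect_eq continuous_intros coord)
  moreover have "compactin (product_topology (\<lambda>x::'a. euclidean :: 'k topology) UNIV)
      (\<Pi>\<^sub>E x\<in>UNIV. cball 0 (norm x))"
    by (simp add: compactin_PiE)
  then have "compact (\<Pi>\<^sub>E x\<in>(UNIV :: 'a set). cball (0 :: 'k) (norm x))"
    by (simp add: euclidean_product_topology)
  ultimately have "compact ({f. (\<forall>x y. f (x + y) = f x + f y) \<and> (\<forall>r x. f (r *\<^sub>R x) = r *\<^sub>R f x) \<and>
    (\<forall>c x. f (smul c x) = c * f x)} \<inter> (\<Pi>\<^sub>E x\<in>UNIV. cball 0 (norm x)))"
    by (rule closed_Int_compact)
  moreover have "\<dots> = dual_ball" by (rule set_eqI) (simp add: dual_ball_iff)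
  ultimately show ?thesis by simp
qed

text \<open>
  Every functional is small at some \<open>v k\<close> with \<open>k \<in> Q\<close>, and this is an open condition on the functional.
\<close>

lemma finitely_many_large_values:
  assumes v: "\<And>f. f \<in> dual_space smul \<Longrightarrow> (\<lambda>k. f (v k)) \<longlonglongrightarrow> 0"
    and Q: "infinite (Q :: nat set)" and e: "0 < e"
  obtains T where "finite T" "T \<subseteq> Q" "\<forall>f\<in>dual_ball. \<exists>k\<in>T. norm (f (v k)) \<le> e"
proof -
  have op: "open {f :: 'a \<Rightarrow> 'k. norm (f (v k)) < e}" for k
    by (intro open_Collect_less continuous_intros continuous_on_product_coordinates)
  have cov: "dual_ball \<subseteq> (\<Union>k\<in>Q. {f. norm (f (v k)) < e})"
  proof
    fix f assume "f \<in> dual_ball"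
    then have "(\<lambda>k. f (v k)) \<longlonglongrightarrow> 0" using v dual_ball_dual_space by blast
    then have "eventually (\<lambda>k. norm (f (v k)) < e) sequentially"
      using e by (simp add: tendsto_iff)
    then obtain k0 where "\<And>k. k0 \<le> k \<Longrightarrow> norm (f (v k)) < e"
      unfolding eventually_sequentially by blast
    moreover obtain k where "k \<in> Q" "k0 \<le> k" using Q by (meson infinite_nat_iff_unbounded_le)
    ultimately show "f \<in> (\<Union>k\<in>Q. {f. norm (f (v k)) < e})" by blast
  qed
  obtain T where "T \<subseteq> Q" "finite T" "dual_ball \<subseteq> (\<Union>k\<in>T. {f. norm (f (v k)) < e})"
    using compactE_image[OF compact_dual_ball op cov] by metis
  then show ?thesis by (intro that[of T]) force+
qed

lemma functional_of_real_functional: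
  assumes "linear F" "\<And>x. F x \<le> norm x"
  obtains G where "G \<in> dual_ball" "\<And>x. re (G x) = F x"
  using extend_real_functional[OF assms] unfolding dual_ball_def by auto

lemma norming_functional:
  obtains f where "f \<in> dual_ball" "norm (f x) = norm x"
proof -
  have "sublinear (norm :: 'a \<Rightarrow> real)"
    by (rule sublinearI) (auto intro: norm_triangle_ineq)
  then obtain F where F: "linear F" "\<And>y. F y \<le> norm y" "F x = norm x"
    using hahn_banach_at[of norm x] by metis
  obtain G where G: "G \<in> dual_ball" "\<And>x. re (G x) = F x"
    using functional_of_real_functional[OF F(1,2)] by metis
  have "norm x \<le> norm (G x)" using abs_re_le[of "G x"] G(2)[of x] F(3) by simp
  then show ?thesis using that[OF G(1)] norm_dual_ball[OF G(1), of x] by simp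
qed

text \<open>
  Hahn--Banach for the distance to \<open>S\<close>, which is a sublinear functional because \<open>S\<close> is a subspace. The
  subspace \<open>S\<close> is only real, hence only the real part of the functional vanishes on it.
\<close>

lemma separating_functional:
  assumes S: "subspace S" and x: "x \<notin> closure S"
  obtains f where "f \<in> dual_ball" "0 < re (f x)" "\<forall>y\<in>closure S. re (f y) = 0"
proof -
  have ne: "S \<noteq> {}" using subspace_0[OF S] by blast
  have "sublinear (\<lambda>x. infdist x S)"
  proof (rule sublinearI)
    fix x y
    have "infdist (x + y) S - dist x a \<le> dist y b" if "a \<in> S" "b \<in> S" for a b
      using infdist_le[of "a + b" S "x + y"] subspace_add[OF S that] dist_triangle_add[of x y a b] by simp
    then have "infdist (x + y) S - dist x a \<le> infdist y S" if "a \<in> S" for a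
      using that ne unfolding infdist_notempty[OF ne, of y] by (intro cINF_greatest) auto
    then have "infdist (x + y) S - infdist y S \<le> infdist x S"
      using ne unfolding infdist_notempty[OF ne, of x] by (intro cINF_greatest) (auto simp: algebra_simps)
    then show "infdist (x + y) S \<le> infdist x S + infdist y S" by simp
  next
    fix t :: real and x assume t: "0 < t"
    have "infdist (t *\<^sub>R x) S / t \<le> dist x a" if "a \<in> S" for a
    proof -
      have "infdist (t *\<^sub>R x) S \<le> dist (t *\<^sub>R x) (t *\<^sub>R a)"
        by (rule infdist_le) (rule subspace_scale[OF S that])
      also have "\<dots> = t * dist x a"
        using t by (simp add: dist_norm flip: scaleR_diff_right)
      finally show ?thesis using t by (simp add: field_simps)
    qed
    then have "infdist (t *\<^sub>R x) S / t \<le> infdist x S"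
      using ne unfolding infdist_notempty[OF ne, of x] by (intro cINF_greatest) auto
    then show "infdist (t *\<^sub>R x) S \<le> t * infdist x S" using t by (simp add: field_simps)
  qed
  then obtain F where F: "linear F" "\<And>y. F y \<le> infdist y S" "F x = infdist x S"
    using hahn_banach_at[of "\<lambda>x. infdist x S" x] by metis
  have "F y \<le> norm y" for y
    using F(2)[of y] infdist_le[OF subspace_0[OF S], of y] by (simp add: dist_norm)
  then obtain G where G: "G \<in> dual_ball" "\<And>x. re (G x) = F x"
    using functional_of_real_functional[OF F(1)] by metis
  show ?thesis
  proof (rule that[OF G(1)])
    show "0 < re (G x)"
      using x F(3) G(2) in_closure_iff_infdist_zero[OF ne, of x] infdist_nonneg[of x S] by simp
  next
    show "\<forall>y\<in>closure S. re (G y) = 0"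
    proof
      fix y assume y: "y \<in> closure S"
      have "0 \<in> closure S" using subspace_0[OF S] closure_subset by blast
      then have my: "- y \<in> closure S" using closure_subspace_diff[OF S _ y, of 0] by simp
      have "F z \<le> 0" if "z \<in> closure S" for z
        using F(2)[of z] that in_closure_iff_infdist_zero[OF ne, of z] by simp
      from this[OF y] this[OF my] show "re (G y) = 0"
        using linear_neg[OF F(1), of y] G(2)[of y] by simp
    qed
  qed
qed

text \<open>
  A lower \<open>\<ell>\<^sub>1\<close>-estimate is what allows a functional to take a common value on all vectors of a finite set.
  The prescribed values are built into a sublinear functional \<open>p\<close>, the infimum over
  all coefficients \<open>a\<close> of \<open>norm (x - (\<Sum>n\<in>E. a\<^sub>n z\<^sub>n)) + d * (\<Sum>n\<in>E. re a\<^sub>n)\<close>. It lies below the norm, and any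
  linear functional below it has real part at most \<open>re (c d)\<close> at \<open>c z\<^sub>n\<close> for every scalar \<open>c\<close>. The lower
  estimate is needed for the infimum to be finite.
\<close>

lemma interpolating_functional:
  fixes z :: "nat \<Rightarrow> 'a"
  assumes E: "finite E" and d: "0 \<le> d"
    and l1: "\<And>a. d * (\<Sum>n\<in>E. norm (a n)) \<le> norm (\<Sum>n\<in>E. smul (a n) (z n))"
  obtains f where "f \<in> dual_ball" "\<And>n. n \<in> E \<Longrightarrow> f (z n) = of_real d"
proof -
  define h where "h a x = norm (x - (\<Sum>n\<in>E. smul (a n) (z n))) + d * (\<Sum>n\<in>E. re (a n))"
    for a :: "nat \<Rightarrow> 'k" and x
  define p where "p x = (INF a. h a x)" for x
  have "- norm x \<le> h a x" for a x
  proof -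
    have "(\<Sum>n\<in>E. - norm (a n)) \<le> (\<Sum>n\<in>E. re (a n))"
    proof (rule sum_mono)
      show "- norm (a n) \<le> re (a n)" for n using abs_re_le[of "a n"] by linarith
    qed
    then have "d * (- (\<Sum>n\<in>E. norm (a n))) \<le> d * (\<Sum>n\<in>E. re (a n))"
      using d by (intro mult_left_mono) (simp_all add: sum_negf)
    then show ?thesis
      using l1[of a] norm_triangle_ineq2[of "\<Sum>n\<in>E. smul (a n) (z n)" x]
      by (simp add: h_def norm_minus_commute)
  qed
  then have p_le: "p x \<le> h a x" for a x
    unfolding p_def by (intro cINF_lower bdd_belowI2) auto
  have p_ge: "(\<And>a. c \<le> h a x) \<Longrightarrow> c \<le> p x" for c x
    unfolding p_def by (intro cINF_greatest) auto
  have "sublinear p"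
  proof (rule sublinearI)
    fix x y
    have "h (\<lambda>n. a n + b n) (x + y) \<le> h a x + h b y" for a b
      using norm_triangle_ineq[of "x - (\<Sum>n\<in>E. smul (a n) (z n))" "y - (\<Sum>n\<in>E. smul (b n) (z n))"]
      by (simp add: h_def linear_add[OF linear_smul_left] linear_add[OF linear_re] sum.distrib
          algebra_simps)
    then have "p (x + y) - h b y \<le> h a x" for a b
      using p_le[of "x + y" "\<lambda>n. a n + b n"] order_trans by (fastforce simp: diff_le_eq)
    then have "p (x + y) - h b y \<le> p x" for b by (rule p_ge)
    then have "p (x + y) - p x \<le> p y" by (intro p_ge) (simp add: algebra_simps)
    then show "p (x + y) \<le> p x + p y" by simp
  next
    fix t :: real and x assume t: "0 < t"
    have "h (\<lambda>n. t *\<^sub>R a n) (t *\<^sub>R x) = t * h a x" for a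
    proof -
      have "t *\<^sub>R x - (\<Sum>n\<in>E. smul (t *\<^sub>R a n) (z n)) = t *\<^sub>R (x - (\<Sum>n\<in>E. smul (a n) (z n)))"
        by (simp add: linear_scale[OF linear_smul_left] scaleR_sum_right algebra_simps)
      then show ?thesis using t
        by (simp add: h_def linear_scale[OF linear_re] distrib_left mult.left_commute flip: sum_distrib_left)
    qed
    then have "p (t *\<^sub>R x) / t \<le> h a x" for a
      using p_le[of "t *\<^sub>R x" "\<lambda>n. t *\<^sub>R a n"] t by (simp add: field_simps)
    then have "p (t *\<^sub>R x) / t \<le> p x" by (rule p_ge)
    then show "p (t *\<^sub>R x) \<le> t * p x" using t by (simp add: field_simps)
  qed
  then obtain F where F: "linear F" "\<And>x. F x \<le> p x" using hahn_banach by metis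
  have F_le: "F x \<le> h a x" for a x using F(2)[of x] p_le[of x a] by simp
  have "F x \<le> norm x" for x
    using F_le[of x "\<lambda>_. 0"] by (simp add: h_def linear_0[OF linear_smul_left] linear_0[OF linear_re])
  then obtain G where G: "G \<in> dual_ball" "\<And>x. re (G x) = F x"
    using functional_of_real_functional[OF F(1)] by metis
  show ?thesis
  proof (rule that[OF G(1)])
    fix m assume m: "m \<in> E"
    have "G (z m) - of_real d = 0"
    proof (rule eq_zero_if_re_mult_nonpos)
      fix c :: 'k
      define a where "a n = (if n = m then c else 0)" for n
      have "smul (a n) (z n) = (if n = m then smul c (z m) else 0)" and "re (a n) = (if n = m then re c else 0)" for n
        by (simp_all add: a_def linear_0[OF linear_smul_left] linear_0[OF linear_re])
      then have "h a (smul c (z m)) = d * re c"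
        using E m by (simp add: h_def)
      then have "re (c * G (z m)) \<le> d * re c"
        using F_le[of "smul c (z m)" a] G(2) dual_space_linear(2)[OF dual_ball_dual_space[OF G(1)]]
        by metis
      moreover have "re (c * of_real d) = d * re c"
        using linear_scale[OF linear_re, of d c] by (simp add: scaleR_conv_of_real mult.commute)
      ultimately show "re (c * (G (z m) - of_real d)) \<le> 0"
        by (simp add: right_diff_distrib linear_diff[OF linear_re])
    qed
    then show "G (z m) = of_real d" by simp
  qed
qed

end

section \<open>Weak limits of sequences in a weak closure\<close>

lemma weakly_convergent_iff:
  "weakly_convergent smul x l \<longleftrightarrow> (\<forall>f\<in>dual_space smul. (\<lambda>n. f (x n)) \<longlonglongrightarrow> f l)"
proof
  assume w: "weakly_convergent smul x l"
  show "\<forall>f\<in>dual_space smul. (\<lambda>n. f (x n)) \<longlonglongrightarrow> f l"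
  proof (intro ballI topological_tendstoI)
    fix f :: "'b \<Rightarrow> 'a" and U assume f: "f \<in> dual_space smul" and U: "open U" "f l \<in> U"
    have "openin (weak_topology smul) (f -` U)"
      unfolding weak_topology_def using f U by (intro topology_generated_by_Basis) blast
    moreover have "l \<in> f -` U" using U by simp
    ultimately have "eventually (\<lambda>n. x n \<in> f -` U) sequentially"
      using w unfolding weakly_convergent_def limitin_def by blast
    then show "eventually (\<lambda>n. f (x n) \<in> U) sequentially" by simp
  qed
next
  assume lim: "\<forall>f\<in>dual_space smul. (\<lambda>n. f (x n)) \<longlonglongrightarrow> f l"
  show "weakly_convergent smul x l"
    unfolding weakly_convergent_def limitin_def
  proof (intro conjI allI impI)
    fix V assume V: "openin (weak_topology smul) V \<and> l \<in> V"
    then have "generate_topology_on {f -` U | f U. f \<in> dual_space smul \<and> open U} V"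
      by (simp add: weak_topology_def openin_topology_generated_by_iff)
    then have "l \<in> V \<longrightarrow> eventually (\<lambda>n. x n \<in> V) sequentially"
    proof induction
      case (Int a b)
      then show ?case by (auto intro: eventually_conj)
    next
      case (UN \<K>)
      show ?case
      proof
        assume "l \<in> \<Union>\<K>"
        then obtain k where k: "k \<in> \<K>" "l \<in> k" by blast
        with UN have "eventually (\<lambda>n. x n \<in> k) sequentially" by blast
        then show "eventually (\<lambda>n. x n \<in> \<Union>\<K>) sequentially"
          by (rule eventually_mono) (use k in blast)
      qed
    next
      case (Basis s)
      then obtain f U where "s = f -` U" "f \<in> dual_space smul" "open U" by blast
      then show ?case using lim by (auto dest: topological_tendstoD)
    qed simp
    with V show "eventually (\<lambda>n. x n \<in> V) sequentially" by blast
  qed simp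
qed

lemma weakly_convergentD:
  "weakly_convergent smul x l \<Longrightarrow> f \<in> dual_space smul \<Longrightarrow> (\<lambda>n. f (x n)) \<longlonglongrightarrow> f l"
  by (simp add: weakly_convergent_iff)

lemma weakly_convergent_subseq:
  assumes "weakly_convergent smul x l" "strict_mono r"
  shows "weakly_convergent smul (x \<circ> r) l"
  using assms(1) LIMSEQ_subseq_LIMSEQ[OF _ assms(2)]
  unfolding weakly_convergent_iff o_def by blast

lemma weak_closure_of_approx:
  assumes x: "x \<in> weak_topology smul closure_of K" and fin: "finite \<Phi>" "\<Phi> \<subseteq> dual_space smul" and e: "0 < e"
  obtains y where "y \<in> K" "\<And>f. f \<in> \<Phi> \<Longrightarrow> dist (f y) (f x) < e"
proof -
  have "openin (weak_topology smul) ((\<Inter>f\<in>\<Phi>. f -` ball (f x) e) \<inter> topspace (weak_topology smul))"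
  proof (intro openin_INT fin(1))
    fix f assume "f \<in> \<Phi>"
    then show "openin (weak_topology smul) (f -` ball (f x) e)"
      unfolding weak_topology_def using fin(2) by (intro topology_generated_by_Basis) blast
  qed
  moreover have "x \<in> (\<Inter>f\<in>\<Phi>. f -` ball (f x) e) \<inter> topspace (weak_topology smul)" using e by simp
  ultimately obtain y where "y \<in> K" "y \<in> (\<Inter>f\<in>\<Phi>. f -` ball (f x) e)"
    using x unfolding in_closure_of by blast
  then show ?thesis by (intro that[of y]) (auto simp: dist_commute)
qed

lemma weak_limit_in_weak_closure:
  assumes "weakly_convergent smul x l" "\<And>n. x n \<in> weak_topology smul closure_of K"
  shows "l \<in> weak_topology smul closure_of K"
  using limitin_closedin[OF assms(1)[unfolded weakly_convergent_def] closedin_closure_of] assms(2)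
  by simp

text \<open>
  The index type is countable, so these combinations form a countable dense subset of the real span
  together with an enumeration. The lists are not normalised: that makes sums concatenations.
\<close>

definition rat_comb :: "(nat \<Rightarrow> 'a::real_vector) \<Rightarrow> (rat \<times> nat) list \<Rightarrow> 'a" where
  "rat_comb y c = (\<Sum>(q, j)\<leftarrow>c. real_of_rat q *\<^sub>R y j)"

lemma closure_range_sequential:
  fixes g :: "'c \<Rightarrow> 'a::metric_space"
  assumes "u \<in> closure (range g)"
  obtains c where "(\<lambda>n. g (c n)) \<longlonglongrightarrow> u"
proof -
  obtain s where s: "\<forall>n. s n \<in> range g" "s \<longlonglongrightarrow> u"
    using assms unfolding closure_sequential by blast
  from s(1) have "\<forall>n. \<exists>c. s n = g c" by (simp add: image_iff)
  from choice[OF this] obtain c where "\<forall>n. s n = g (c n)" ..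
  then have "s = (\<lambda>n. g (c n))" by (intro ext) simp
  with s(2) show ?thesis by (intro that[of c]) simp
qed

lemma scaleR_rat_comb: "real_of_rat s *\<^sub>R rat_comb y c = rat_comb y (map (\<lambda>p. (s * fst p, snd p)) c)"
  by (induction c) (simp_all add: rat_comb_def of_rat_mult scaleR_add_right case_prod_unfold)

lemma span_subset_closure_rat_comb:
  fixes y :: "nat \<Rightarrow> 'a::real_normed_vector"
  shows "span (range y) \<subseteq> closure (range (rat_comb y))"
proof (rule span_minimal)
  have "rat_comb y [(1, j)] = y j" for j by (simp add: rat_comb_def)
  then have "y j \<in> range (rat_comb y)" for j using rangeI[of "rat_comb y" "[(1, j)]"] by simp
  then have "range y \<subseteq> range (rat_comb y)" by (rule image_subsetI)
  then show "range y \<subseteq> closure (range (rat_comb y))" by (rule subset_trans[OF _ closure_subset])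
  show "subspace (closure (range (rat_comb y)))"
  proof (rule subspaceI)
    have "rat_comb y [] = 0" by (simp add: rat_comb_def)
    then have "0 \<in> range (rat_comb y)" using rangeI[of "rat_comb y" "[]"] by simp
    then show "0 \<in> closure (range (rat_comb y))" by (rule subsetD[OF closure_subset])
  next
    fix u v assume uv: "u \<in> closure (range (rat_comb y))" "v \<in> closure (range (rat_comb y))"
    obtain c where c: "(\<lambda>n. rat_comb y (c n)) \<longlonglongrightarrow> u"
      using uv(1) by (rule closure_range_sequential[of u "rat_comb y"])
    obtain d where d: "(\<lambda>n. rat_comb y (d n)) \<longlonglongrightarrow> v"
      using uv(2) by (rule closure_range_sequential[of v "rat_comb y"])
    have "(\<lambda>n. rat_comb y (c n @ d n)) \<longlonglongrightarrow> u + v"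
      using tendsto_add[OF c d] by (simp add: rat_comb_def)
    then show "u + v \<in> closure (range (rat_comb y))"
      unfolding closure_sequential by (intro exI[of _ "\<lambda>n. rat_comb y (c n @ d n)"]) simp
  next
    fix t u assume "u \<in> closure (range (rat_comb y))"
    then obtain c where c: "(\<lambda>n. rat_comb y (c n)) \<longlonglongrightarrow> u"
      by (rule closure_range_sequential[of u "rat_comb y"])
    have "\<exists>q. t < real_of_rat q \<and> real_of_rat q < t + 1 / real (Suc n)" for n
      by (rule of_rat_dense) simp
    then have "\<exists>q. \<forall>n. t < real_of_rat (q n) \<and> real_of_rat (q n) < t + 1 / real (Suc n)"
      by (intro choice allI)
    then obtain q where q: "\<And>n. t < real_of_rat (q n)" "\<And>n. real_of_rat (q n) < t + 1 / real (Suc n)"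
      by blast
    have "(\<lambda>n. t + 1 / real (Suc n)) \<longlonglongrightarrow> t + 0"
      by (rule tendsto_add[OF tendsto_const LIMSEQ_Suc[OF lim_1_over_n]])
    then have "(\<lambda>n. t + 1 / real (Suc n)) \<longlonglongrightarrow> t" by simp
    then have "(\<lambda>n. real_of_rat (q n)) \<longlonglongrightarrow> t"
      using q by (intro tendsto_sandwich[of "\<lambda>_. t" "\<lambda>n. real_of_rat (q n)" sequentially
            "\<lambda>n. t + 1 / real (Suc n)"] always_eventually allI less_imp_le tendsto_const)
    then have "(\<lambda>n. real_of_rat (q n) *\<^sub>R rat_comb y (c n)) \<longlonglongrightarrow> t *\<^sub>R u"
      using c by (rule tendsto_scaleR)
    moreover have "real_of_rat (q n) *\<^sub>R rat_comb y (c n) \<in> range (rat_comb y)" for n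
      unfolding scaleR_rat_comb by (rule rangeI)
    ultimately show "t *\<^sub>R u \<in> closure (range (rat_comb y))"
      unfolding closure_sequential
      by (intro exI[of _ "\<lambda>n. real_of_rat (q n) *\<^sub>R rat_comb y (c n)"]) simp
  qed
qed

context banach_scalars
begin

definition norming :: "'a \<Rightarrow> 'a \<Rightarrow> 'k" where
  "norming x = (SOME f. f \<in> dual_ball \<and> norm (f x) = norm x)"

lemma norming_dual_ball: "norming x \<in> dual_ball" and norm_norming: "norm (norming x x) = norm x"
proof -
  have "\<exists>f. f \<in> dual_ball \<and> norm (f x) = norm x" using norming_functional[of x] by metis
  then have "norming x \<in> dual_ball \<and> norm (norming x x) = norm x"
    unfolding norming_def by (rule someI_ex)
  then show "norming x \<in> dual_ball" "norm (norming x x) = norm x" by simp_all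
qed

lemma dual_ball_diff: "f \<in> dual_ball \<Longrightarrow> f (x - y) = f x - f y"
  using dual_space_linear(1)[OF dual_ball_dual_space] linear_diff by blast

text \<open>
  Countably many functionals separate the points of a separable subspace: the functional that
  norms a combination close to \<open>d\<close> cannot vanish at \<open>d\<close>.
\<close>

lemma norming_rat_comb_separates:
  assumes d: "d \<in> closure (span (range y))" and zero: "\<And>c. norming (rat_comb y c) d = 0"
  shows "d = 0"
proof (rule ccontr)
  assume "d \<noteq> 0"
  have "d \<in> closure (range (rat_comb y))"
    using d closure_minimal[OF span_subset_closure_rat_comb closed_closure] by blast
  then obtain c where c: "norm (rat_comb y c - d) < norm d / 2"
    unfolding closure_approachable dist_norm using \<open>d \<noteq> 0\<close> by (metis half_gt_zero rangeE zero_less_norm_iff)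
  define f where "f = norming (rat_comb y c)"
  have f: "f \<in> dual_ball" unfolding f_def by (rule norming_dual_ball)
  have "norm (rat_comb y c) = norm (f (rat_comb y c - d))"
    using zero[of c] by (simp add: dual_ball_diff[OF f]) (simp add: f_def norm_norming)
  also have "\<dots> \<le> norm (rat_comb y c - d)" by (rule norm_dual_ball[OF f])
  finally show False
    using c norm_triangle_ineq4[of "rat_comb y c" "rat_comb y c - d"] by simp
qed

lemma weak_limit_in_closed_subspace:
  assumes S: "subspace S" and x: "\<And>n. x n \<in> closure S" and l: "weakly_convergent smul x l"
  shows "l \<in> closure S"
proof (rule ccontr)
  assume "l \<notin> closure S"
  then obtain f where f: "f \<in> dual_ball" "0 < re (f l)" "\<forall>y\<in>closure S. re (f y) = 0"
    by (rule separating_functional[OF S])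
  have lim: "(\<lambda>n. f (x n) - f l) \<longlonglongrightarrow> 0"
    using weakly_convergentD[OF l dual_ball_dual_space[OF f(1)]] by (simp add: LIM_zero)
  have le: "norm (re (f l)) \<le> norm (f (x n) - f l)" for n
    using abs_re_le[of "f (x n) - f l"] bspec[OF f(3) x[of n]] by (simp add: linear_diff[OF linear_re])
  have "(\<lambda>n. re (f l)) \<longlonglongrightarrow> 0"
    by (rule Lim_null_comparison[OF always_eventually[OF allI[OF le]] tendsto_norm_zero[OF lim]])
  then show False using f(2) by (simp add: LIMSEQ_const_iff)
qed

definition weakly_sequentially_precompact :: "'a set \<Rightarrow> bool" where
  "weakly_sequentially_precompact K \<longleftrightarrow>
    (\<forall>y :: nat \<Rightarrow> 'a. (\<forall>n. y n \<in> K) \<longrightarrow> (\<exists>r l. strict_mono r \<and> weakly_convergent smul (y \<circ> r) l))"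

text \<open>
  Whitley's construction. The \<open>n\<close>-th term is chosen in \<open>K\<close> close to \<open>x\<close> on finitely many functionals that norm
  rational combinations of \<open>x\<close> and the previous terms. In the limit all rational combinations
  of the sequence are taken into account, so that the functionals separate the points of the
  closed span, in which any weak limit \<open>l\<close> of a subsequence and \<open>x\<close> itself lie. They do not distinguish
  \<open>l\<close> from \<open>x\<close>.
\<close>

lemma weak_closure_point_is_sequential_limit:
  assumes K: "weakly_sequentially_precompact K" and x: "x \<in> weak_topology smul closure_of K"
  obtains y where "\<And>n. y n \<in> K" "weakly_convergent smul y x"
proof -
  \<comment> \<open>Only combinations of the terms up to \<open>n\<close> are used at stage \<open>n\<close>; \<open>a 0\<close> is \<open>x\<close> and \<open>a (Suc n)\<close> is the point chosen at stage \<open>n\<close>.\<close>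
  define near where "near a n v \<longleftrightarrow> v \<in> K \<and> (\<forall>c. to_nat c \<le> n \<longrightarrow> snd ` set c \<subseteq> {..n} \<longrightarrow>
      dist (norming (rat_comb a c) v) (norming (rat_comb a c) x) < 1 / real (Suc n))"
    for a :: "nat \<Rightarrow> 'a" and n :: nat and v :: 'a
  define P where "P a m v \<longleftrightarrow> (m = 0 \<longrightarrow> v = x) \<and> (0 < m \<longrightarrow> near a (m - 1) v)"
    for a :: "nat \<Rightarrow> 'a" and m :: nat and v :: 'a
  have "\<exists>a. \<forall>m. P a m (a m)"
  proof (rule dependent_wellorder_choice[of P])
    fix v :: 'a and a b :: "nat \<Rightarrow> 'a" and m :: nat
    assume ab: "\<And>j. j < m \<Longrightarrow> a j = b j"
    have "rat_comb a c = rat_comb b c" if "0 < m" "snd ` set c \<subseteq> {..m - 1}" for c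
    proof -
      have "snd p < m" if "p \<in> set c" for p
        using \<open>snd ` set c \<subseteq> {..m - 1}\<close> \<open>0 < m\<close> that by fastforce
      then show ?thesis
        unfolding rat_comb_def using ab by (intro arg_cong[of _ _ sum_list] map_cong) auto
    qed
    then have "0 < m \<Longrightarrow> near a (m - 1) v = near b (m - 1) v"
      unfolding near_def by simp
    then show "P a m v = P b m v"
      unfolding P_def by blast
  next
    fix m and a :: "nat \<Rightarrow> 'a"
    let ?\<Phi> = "(\<lambda>c. norming (rat_comb a c)) ` {c. to_nat c \<le> m - 1}"
    have "finite {c :: (rat \<times> nat) list. to_nat c \<le> m - 1}"
      by (rule finite_imageD[of to_nat]) (auto intro: finite_subset[of _ "{..m - 1}"] inj_on_subset[OF inj_to_nat])
    moreover have "?\<Phi> \<subseteq> dual_space smul" using dual_ball_dual_space[OF norming_dual_ball] by blast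
    ultimately obtain v where "v \<in> K" "\<And>f. f \<in> ?\<Phi> \<Longrightarrow> dist (f v) (f x) < 1 / real (Suc (m - 1))"
      using weak_closure_of_approx[OF x, of ?\<Phi> "1 / real (Suc (m - 1))"] by auto
    then have "near a (m - 1) v" by (simp add: near_def)
    then show "\<exists>v. P a m v" by (cases "m = 0") (auto simp: P_def)
  qed
  then obtain a where a: "\<And>m. P a m (a m)" by blast
  define y where "y n = a (Suc n)" for n
  have a0: "a 0 = x" using a[of 0] by (simp add: P_def)
  have yK: "y n \<in> K" for n using a[of "Suc n"] by (simp add: P_def y_def near_def)
  obtain r l where r: "strict_mono r" and l: "weakly_convergent smul (y \<circ> r) l"
    using K yK unfolding weakly_sequentially_precompact_def by blast
  let ?S = "span (range a)"
  have base: "a j \<in> closure ?S" for j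
    by (intro subsetD[OF closure_subset] span_base) simp
  have "x \<in> closure ?S" using base[of 0] a0 by simp
  moreover have "l \<in> closure ?S"
  proof (rule weak_limit_in_closed_subspace[OF subspace_span _ l])
    show "(y \<circ> r) n \<in> closure ?S" for n
      using base by (simp add: y_def)
  qed
  ultimately have "l - x \<in> closure ?S" by (intro closure_subspace_diff subspace_span)
  moreover have "norming (rat_comb a c) l = norming (rat_comb a c) x" for c
  proof -
    let ?f = "norming (rat_comb a c)"
    have "finite (snd ` set c)" by simp
    then obtain m where m: "snd ` set c \<subseteq> {..m}" unfolding finite_nat_iff_bounded_le by blast
    have "dist (?f (y n)) (?f x) < 1 / real (Suc n)" if "max m (to_nat c) \<le> n" for n
    proof -
      have "snd ` set c \<subseteq> {..n}" using m that by force
      moreover have "near a n (y n)" using a[of "Suc n"] by (simp add: P_def y_def)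
      ultimately show ?thesis using that by (simp add: near_def)
    qed
    then have "eventually (\<lambda>n. norm (?f (y n) - ?f x) \<le> 1 / real (Suc n)) sequentially"
      unfolding eventually_sequentially dist_norm using less_imp_le by blast
    then have "(\<lambda>n. ?f (y n) - ?f x) \<longlonglongrightarrow> 0"
      by (rule Lim_null_comparison) (rule LIMSEQ_Suc[OF lim_1_over_n])
    then have "(\<lambda>n. ?f (y n)) \<longlonglongrightarrow> ?f x" by (simp add: LIM_zero_cancel)
    then have "(\<lambda>n. ?f ((y \<circ> r) n)) \<longlonglongrightarrow> ?f x"
      using LIMSEQ_subseq_LIMSEQ[OF _ r] by (fastforce simp: o_def)
    then show ?thesis
      using LIMSEQ_unique weakly_convergentD[OF l dual_ball_dual_space[OF norming_dual_ball]] by blast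
  qed
  ultimately have "l - x = 0"
    by (intro norming_rat_comb_separates[of _ a]) (auto simp: dual_ball_diff[OF norming_dual_ball])
  then have "weakly_convergent smul (y \<circ> r) x" using l by simp
  then show ?thesis using that[of "y \<circ> r"] yK by simp
qed

end

section \<open>Weak sequential compactness of the weak closure\<close>

lemma subsequence_away_from_limit:
  fixes x :: "nat \<Rightarrow> 'c::metric_space"
  assumes "\<not> x \<longlonglongrightarrow> l"
  obtains e s where "0 < e" "strict_mono (s :: nat \<Rightarrow> nat)" "\<forall>j. e \<le> dist (x (s j)) l"
proof -
  obtain e where e: "0 < e" "\<not> (\<exists>m. \<forall>n\<ge>m. dist (x n) l < e)"
    using assms unfolding lim_sequentially by blast
  then have inf: "infinite {n. e \<le> dist (x n) l}"
    unfolding infinite_nat_iff_unbounded_le by (meson mem_Collect_eq not_le)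
  show ?thesis
  proof (rule that[OF e(1)])
    show "strict_mono (enumerate {n. e \<le> dist (x n) l})" by (rule strict_mono_enumerate[OF inf])
    show "\<forall>j. e \<le> dist (x (enumerate {n. e \<le> dist (x n) l} j)) l"
      using enumerate_in_set[OF inf] by simp
  qed
qed

context banach_scalars
begin

text \<open>
  Uniformity in \<open>k\<close> makes every diagonal sequence follow \<open>x\<close> on all the \<open>f i\<close>, whatever terms are picked from
  the rows. The set \<open>D\<close> captures the weak limits of such sequences, which are therefore determined
  by the behaviour of \<open>x\<close> on the \<open>f i\<close>.
\<close>

definition approximating_array ::
  "'a set \<Rightarrow> (nat \<Rightarrow> 'a) \<Rightarrow> (nat \<Rightarrow> nat \<Rightarrow> 'a) \<Rightarrow> (nat \<Rightarrow> 'a \<Rightarrow> 'k) \<Rightarrow> 'a set \<Rightarrow> bool" where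
  "approximating_array K x y f D \<longleftrightarrow>
    (\<forall>n k. y n k \<in> K \<inter> D) \<and> (\<forall>n. weakly_convergent smul (y n) (x n)) \<and>
    (\<forall>i. f i \<in> dual_space smul) \<and>
    (\<forall>n k. \<forall>i\<le>n. dist (f i (y n k)) (f i (x n)) < 1 / real (Suc n)) \<and>
    (\<forall>u l. (\<forall>j. u j \<in> D) \<longrightarrow> weakly_convergent smul u l \<longrightarrow> l \<in> D) \<and>
    (\<forall>l\<in>D. \<forall>l'\<in>D. (\<forall>i. f i l = f i l') \<longrightarrow> l = l')"

lemma approximating_arrayD:
  assumes "approximating_array K x y f D"
  shows "y n k \<in> K" "weakly_convergent smul (y n) (x n)" "f i \<in> dual_space smul"
    "i \<le> n \<Longrightarrow> dist (f i (y n k)) (f i (x n)) < 1 / real (Suc n)"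
    "y n k \<in> D" "(\<And>j. u j \<in> D) \<Longrightarrow> weakly_convergent smul u l \<Longrightarrow> l \<in> D"
    "l \<in> D \<Longrightarrow> l' \<in> D \<Longrightarrow> (\<And>i. f i l = f i l') \<Longrightarrow> l = l'"
proof -
  note * = assms[unfolded approximating_array_def]
  show "y n k \<in> K" "y n k \<in> D" "weakly_convergent smul (y n) (x n)" "f i \<in> dual_space smul"
    "i \<le> n \<Longrightarrow> dist (f i (y n k)) (f i (x n)) < 1 / real (Suc n)"
    using * by simp_all
  have closed: "\<forall>u l. (\<forall>j. u j \<in> D) \<longrightarrow> weakly_convergent smul u l \<longrightarrow> l \<in> D"
    and separated: "\<forall>l\<in>D. \<forall>l'\<in>D. (\<forall>i. f i l = f i l') \<longrightarrow> l = l'"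
    using * by simp_all
  show "l \<in> D" if "\<And>j. u j \<in> D" "weakly_convergent smul u l"
    using closed[rule_format, of u l] that by simp
  show "l = l'" if "l \<in> D" "l' \<in> D" "\<And>i. f i l = f i l'"
    using separated[rule_format, of l l'] that by simp
qed

lemma approximating_array_exists:
  fixes x :: "nat \<Rightarrow> 'a"
  assumes K: "weakly_sequentially_precompact K" and x: "\<And>n. x n \<in> weak_topology smul closure_of K"
  shows "\<exists>y f D. approximating_array K x y f D"
proof -
  have "\<exists>y. (\<forall>k. y k \<in> K) \<and> weakly_convergent smul y (x n)" for n
    using weak_closure_point_is_sequential_limit[OF K x] by metis
  then obtain y\<^sub>0 where y\<^sub>0: "\<And>n k. y\<^sub>0 n k \<in> K" "\<And>n. weakly_convergent smul (y\<^sub>0 n) (x n)"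
    by metis
  define Y where "Y m = y\<^sub>0 (fst (prod_decode m)) (snd (prod_decode m))" for m
  define D where "D = closure (span (range Y))"
  define f where "f i = norming (rat_comb Y (from_nat i))" for i
  have YD: "Y m \<in> D" for m
    unfolding D_def by (intro subsetD[OF closure_subset] span_base) simp
  have yD: "y\<^sub>0 n k \<in> D" for n k
    using YD[of "prod_encode (n, k)"] by (simp add: Y_def)
  have f_ball: "f i \<in> dual_ball" for i unfolding f_def by (rule norming_dual_ball)
  note f_dual = dual_ball_dual_space[OF f_ball]
  have "\<exists>m. \<forall>k\<ge>m. \<forall>i\<in>{..n}. dist (f i (y\<^sub>0 n k)) (f i (x n)) < 1 / real (Suc n)" for n
  proof -
    have "eventually (\<lambda>k. \<forall>i\<in>{..n}. dist (f i (y\<^sub>0 n k)) (f i (x n)) < 1 / real (Suc n)) sequentially"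
    proof (intro eventually_ball_finite ballI finite_atMost)
      fix i
      show "eventually (\<lambda>k. dist (f i (y\<^sub>0 n k)) (f i (x n)) < 1 / real (Suc n)) sequentially"
        by (rule tendstoD[OF weakly_convergentD[OF y\<^sub>0(2) f_dual]]) simp
    qed
    then show ?thesis unfolding eventually_sequentially .
  qed
  then obtain m where m: "\<And>n k i. m n \<le> k \<Longrightarrow> i \<le> n \<Longrightarrow> dist (f i (y\<^sub>0 n k)) (f i (x n)) < 1 / real (Suc n)"
    by (metis atMost_iff)
  \<comment> \<open>Dropping an initial segment of each sequence makes the approximation uniform in \<open>k\<close>.\<close>
  define y where "y n k = y\<^sub>0 n (k + m n)" for n k
  have "approximating_array K x y f D"
    unfolding approximating_array_def
  proof (intro conjI allI ballI impI)
    show "y n k \<in> K \<inter> D" for n k by (simp add: y_def y\<^sub>0(1) yD)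
    show "weakly_convergent smul (y n) (x n)" for n
    proof -
      have "strict_mono (\<lambda>k. k + m n)" by (simp add: strict_mono_def)
      from weakly_convergent_subseq[OF y\<^sub>0(2)[of n] this] show ?thesis
        by (simp add: o_def y_def[abs_def])
    qed
    show "f i \<in> dual_space smul" for i by (rule f_dual)
    show "dist (f i (y n k)) (f i (x n)) < 1 / real (Suc n)" if "i \<le> n" for i n k
      unfolding y_def using m that by simp
    show "l \<in> D" if "\<forall>j. u j \<in> D" "weakly_convergent smul u l" for u l
      using weak_limit_in_closed_subspace[OF subspace_span _ that(2), of "range Y"] that(1)
      unfolding D_def by simp
    show "l = l'" if l: "l \<in> D" "l' \<in> D" "\<forall>i. f i l = f i l'" for l l'
    proof -
      have "norming (rat_comb Y c) (l - l') = 0" for c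
        using l(3)[rule_format, of "to_nat c"] by (simp add: f_def dual_ball_diff[OF norming_dual_ball])
      moreover have "l - l' \<in> closure (span (range Y))"
        using l(1,2) unfolding D_def by (intro closure_subspace_diff subspace_span)
      ultimately have "l - l' = 0" by (intro norming_rat_comb_separates)
      then show ?thesis by simp
    qed
  qed
  then show ?thesis by blast
qed

lemma diagonal_limit_values:
  fixes x :: "nat \<Rightarrow> 'a" and y :: "nat \<Rightarrow> nat \<Rightarrow> 'a"
  assumes near: "\<And>i n k. i \<le> n \<Longrightarrow> dist (f i (y n k)) (f i (x n) :: 'k) < 1 / real (Suc n)"
    and f: "f i \<in> dual_space smul" and r: "strict_mono r"
    and l: "weakly_convergent smul (\<lambda>j. y (r j) (\<kappa> j)) l"
  shows "(\<lambda>j. f i (x (r j))) \<longlonglongrightarrow> f i l"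
proof -
  have "eventually (\<lambda>n. \<forall>k. dist (f i (y n k)) (f i (x n)) \<le> 1 / real (Suc n)) sequentially"
    unfolding eventually_sequentially using near less_imp_le by blast
  then have "eventually (\<lambda>j. \<forall>k. dist (f i (y (r j) k)) (f i (x (r j))) \<le> 1 / real (Suc (r j))) sequentially"
    by (rule eventually_subseq[OF r])
  then have "eventually (\<lambda>j. norm (f i (y (r j) (\<kappa> j)) - f i (x (r j))) \<le> 1 / real (Suc (r j))) sequentially"
    by (rule eventually_mono) (simp add: dist_norm)
  moreover have "(\<lambda>j. 1 / real (Suc (r j))) \<longlonglongrightarrow> 0"
    using LIMSEQ_subseq_LIMSEQ[OF LIMSEQ_Suc[OF lim_1_over_n] r] by (simp add: o_def)
  ultimately have "(\<lambda>j. f i (y (r j) (\<kappa> j)) - f i (x (r j))) \<longlonglongrightarrow> 0"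
    by (rule Lim_null_comparison)
  from tendsto_diff[OF weakly_convergentD[OF l f] this] show ?thesis by simp
qed

text \<open>
  A diagonal sequence in \<open>K\<close> has a weakly convergent subsequence, and along it the values \<open>f i (x n)\<close>
  converge to those of the limit \<open>l\<close>. If some functional \<open>g\<close> did not
  converge to \<open>g l\<close> along \<open>x\<close>, one could choose another diagonal sequence that also follows \<open>x\<close> on \<open>g\<close>. Its
  weak limit would agree with \<open>l\<close> on all \<open>f i\<close>, hence equal \<open>l\<close>, but not on \<open>g\<close>.
\<close>

lemma weak_closure_sequentially_precompact:
  fixes x :: "nat \<Rightarrow> 'a"
  assumes K: "weakly_sequentially_precompact K" and x: "\<And>n. x n \<in> weak_topology smul closure_of K"
  obtains r l where "strict_mono r" "weakly_convergent smul (x \<circ> r) l"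
proof -
  obtain y f D where array: "approximating_array K x y f D"
    using approximating_array_exists[of K x] K x by blast
  note yK = approximating_arrayD(1)[OF array] and yx = approximating_arrayD(2)[OF array]
    and f = approximating_arrayD(3)[OF array] and near = approximating_arrayD(4)[OF array]
    and D = approximating_arrayD(5-7)[OF array]
  have pick: "\<exists>r l. strict_mono r \<and> weakly_convergent smul (\<lambda>j. y (p (r j)) (\<kappa> (r j))) l"
    for p \<kappa> :: "nat \<Rightarrow> nat"
    using K[unfolded weakly_sequentially_precompact_def, rule_format, of "\<lambda>j. y (p j) (\<kappa> j)"] yK
    by (simp add: o_def)
  obtain r l where r: "strict_mono r" and l: "weakly_convergent smul (\<lambda>j. y (r j) 0) l"
    using pick[of "\<lambda>j. j" "\<lambda>_. 0"] by blast
  have lD: "l \<in> D" by (rule D(2)[OF D(1) l])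
  have "(\<lambda>j. g (x (r j))) \<longlonglongrightarrow> g l" if g: "g \<in> dual_space smul" for g
  proof (rule ccontr)
    assume "\<not> (\<lambda>j. g (x (r j))) \<longlonglongrightarrow> g l"
    then obtain e and s :: "nat \<Rightarrow> nat" where e: "0 < e" and s: "strict_mono s" and away: "\<forall>j. e \<le> dist (g (x (r (s j)))) (g l)"
      by (rule subsequence_away_from_limit)
    have "\<exists>k. dist (g (y n k)) (g (x n)) < e / 2" for n
    proof -
      have "eventually (\<lambda>k. dist (g (y n k)) (g (x n)) < e / 2) sequentially"
        by (rule tendstoD[OF weakly_convergentD[OF yx g]]) (use e in simp)
      then show ?thesis unfolding eventually_sequentially by blast
    qed
    then obtain \<kappa> where \<kappa>: "\<And>n. dist (g (y n (\<kappa> n))) (g (x n)) < e / 2" by metis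
    obtain t l' where t: "strict_mono t"
      and l': "weakly_convergent smul (\<lambda>j. y (r (s (t j))) (\<kappa> (r (s (t j))))) l'"
      using pick[of "\<lambda>j. r (s j)" "\<lambda>j. \<kappa> (r (s j))"] by blast
    have rst: "strict_mono (\<lambda>j. r (s (t j)))" and st: "strict_mono (\<lambda>j. s (t j))"
      using r s t by (simp_all add: strict_mono_def)
    have "l' = l"
    proof (rule D(3)[OF D(2)[OF D(1) l'] lD])
      fix i
      have "(\<lambda>j. f i (x (r (s (t j))))) \<longlonglongrightarrow> f i l'"
        using diagonal_limit_values[where f = f and y = y, OF near f rst l'] .
      moreover have "(\<lambda>j. f i (x (r (s (t j))))) \<longlonglongrightarrow> f i l"
        using LIMSEQ_subseq_LIMSEQ[OF diagonal_limit_values[where f = f and y = y, OF near f r l] st]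
        by (simp add: o_def)
      ultimately show "f i l' = f i l" by (rule LIMSEQ_unique)
    qed
    then have "(\<lambda>j. g (y (r (s (t j))) (\<kappa> (r (s (t j)))))) \<longlonglongrightarrow> g l"
      using weakly_convergentD[OF l' g] by simp
    then have "eventually (\<lambda>j. dist (g (y (r (s (t j))) (\<kappa> (r (s (t j)))))) (g l) < e / 2) sequentially"
      by (rule tendstoD) (use e in simp)
    then obtain j where "dist (g (y (r (s (t j))) (\<kappa> (r (s (t j)))))) (g l) < e / 2"
      unfolding eventually_sequentially by blast
    with \<kappa>[of "r (s (t j))"] away[rule_format, of "t j"] show False
      using dist_triangle2[of "g (x (r (s (t j))))" "g l" "g (y (r (s (t j))) (\<kappa> (r (s (t j)))))"]
        dist_triangle[of "g (x (r (s (t j))))" "g l" "g (y (r (s (t j))) (\<kappa> (r (s (t j)))))"]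
      by (simp add: dist_commute)
  qed
  then have "weakly_convergent smul (x \<circ> r) l" by (simp add: weakly_convergent_iff)
  then show ?thesis using that r by blast
qed

text \<open>
  A weak limit of a diagonal sequence has the values \<open>f i x\<^sub>0\<close> at the separating functionals of an
  approximating array, because the sequence follows \<open>x\<close> on them.
\<close>

lemma diagonal_sequences_same_limit:
  fixes x :: "nat \<Rightarrow> 'a"
  assumes K: "weakly_sequentially_precompact K" and x: "\<And>n. x n \<in> weak_topology smul closure_of K"
    and lim: "weakly_convergent smul x x\<^sub>0"
  shows "\<exists>y. (\<forall>n k. y n k \<in> K) \<and> (\<forall>n. weakly_convergent smul (y n) (x n)) \<and>
    (\<forall>r \<kappa> l. strict_mono r \<longrightarrow> weakly_convergent smul (\<lambda>j. y (r j) (\<kappa> j :: nat)) l \<longrightarrow> l = x\<^sub>0)"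
proof -
  obtain y f D where array: "approximating_array K x y f D"
    using approximating_array_exists[of K x] K x by blast
  note yK = approximating_arrayD(1)[OF array] and yx = approximating_arrayD(2)[OF array]
    and f = approximating_arrayD(3)[OF array] and near = approximating_arrayD(4)[OF array]
    and D = approximating_arrayD(5-7)[OF array]
  have x\<^sub>0D: "x\<^sub>0 \<in> D" by (rule D(2)[OF D(2)[OF D(1) yx] lim])
  show ?thesis
  proof (intro exI[of _ y] conjI allI impI yK yx)
    fix r and \<kappa> :: "nat \<Rightarrow> nat" and l assume r: "strict_mono r" and l: "weakly_convergent smul (\<lambda>j. y (r j) (\<kappa> j)) l"
    show "l = x\<^sub>0"
    proof (rule D(3)[OF D(2)[OF D(1) l] x\<^sub>0D])
      fix i
      have "(\<lambda>j. f i (x (r j))) \<longlonglongrightarrow> f i l"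
        using diagonal_limit_values[where f = f and y = y, OF near f r l] .
      moreover have "(\<lambda>j. f i (x (r j))) \<longlonglongrightarrow> f i x\<^sub>0"
        using LIMSEQ_subseq_LIMSEQ[OF weakly_convergentD[OF lim f] r] by (simp add: o_def)
      ultimately show "f i l = f i x\<^sub>0" by (rule LIMSEQ_unique)
    qed
  qed
qed

end

section \<open>Functionals prescribed along a diagonal sequence\<close>

context banach_scalars
begin

text \<open>
  Functionals in finitely many sets \<open>C\<close> are given that take the value \<open>d\<close> at the \<open>z n\<close> with \<open>n \<in> H\<close>.
  For a suitable \<open>k\<close> and after thinning out \<open>N\<close>, such a functional can be replaced by one that is
  small at \<open>v k\<close>, for all finite \<open>H\<close> at once.

  Call \<open>H\<close> bad for \<open>k\<close> and \<open>C\<close> if this is impossible. If every \<open>k\<close> fails, Galvin's lemma provides shrinking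
  reservoirs in which every infinite set has a bad initial segment for the first \<open>k\<close>, the second \<open>k\<close>, and
  so on, with the same \<open>C\<close> for infinitely many of them. Badness is inherited by larger
  interpolating sets as long as interpolation remains possible; therefore a functional for the longest of
  finitely many bad initial segments is large at all the corresponding \<open>v k\<close>. This contradicts
  compactness of the dual ball.
\<close>

lemma functional_values_can_be_made_small:
  fixes v z :: "nat \<Rightarrow> 'a"
  assumes v: "\<And>f. f \<in> dual_space smul \<Longrightarrow> (\<lambda>k. f (v k)) \<longlonglongrightarrow> 0"
    and Q: "infinite Q" and N: "infinite N" and e: "0 < e"
    and fin: "finite \<C>" and ball: "\<And>C. C \<in> \<C> \<Longrightarrow> C \<subseteq> dual_ball"
  shows "\<exists>k\<in>Q. \<exists>M. infinite M \<and> M \<subseteq> N \<and> (\<forall>C\<in>\<C>. \<forall>H. finite H \<and> H \<subseteq> M \<longrightarrow>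
    (\<exists>g\<in>C. \<forall>n\<in>H. g (z n) = d) \<longrightarrow> (\<exists>g\<in>C. (\<forall>n\<in>H. g (z n) = d) \<and> norm (g (v k)) \<le> e))"
proof (rule ccontr)
  assume contr: "\<not> ?thesis"
  define bad where "bad k C H \<longleftrightarrow> (\<exists>g\<in>C. \<forall>n\<in>H. g (z n) = d) \<and>
    (\<forall>g\<in>C. (\<forall>n\<in>H. g (z n) = d) \<longrightarrow> e < norm (g (v k)))" for k C H
  define barrier where "barrier k C M \<longleftrightarrow> (\<forall>L. infinite L \<and> L \<subseteq> M \<longrightarrow> (\<exists>m. bad k C (L \<inter> {..<m})))"
    for k C M
  have step: "\<exists>M'. \<exists>C\<in>\<C>. infinite M' \<and> M' \<subseteq> M \<and> barrier k C M'"
    if k: "k \<in> Q" and M: "infinite M" "M \<subseteq> N" for k M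
  proof -
    obtain M' where M': "infinite M'" "M' \<subseteq> M"
      "(\<forall>C\<in>\<C>. \<forall>H. finite H \<and> H \<subseteq> M' \<longrightarrow> \<not> bad k C H) \<or>
       (\<exists>C\<in>\<C>. \<forall>L. infinite L \<and> L \<subseteq> M' \<longrightarrow> (\<exists>m. bad k C (L \<inter> {..<m})))"
      by (rule infinite_subset_avoids_or_barrier_finite[OF fin M(1), of "bad k"])
    from M'(3) show ?thesis
    proof
      assume a: "\<forall>C\<in>\<C>. \<forall>H. finite H \<and> H \<subseteq> M' \<longrightarrow> \<not> bad k C H"
      have "\<forall>C\<in>\<C>. \<forall>H. finite H \<and> H \<subseteq> M' \<longrightarrow>
        (\<exists>g\<in>C. \<forall>n\<in>H. g (z n) = d) \<longrightarrow> (\<exists>g\<in>C. (\<forall>n\<in>H. g (z n) = d) \<and> norm (g (v k)) \<le> e)"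
      proof (intro ballI allI impI)
        fix C H assume "C \<in> \<C>" "finite H \<and> H \<subseteq> M'" and ex: "\<exists>g\<in>C. \<forall>n\<in>H. g (z n) = d"
        then have "\<not> bad k C H" using a by simp
        then obtain g where "g \<in> C" "\<forall>n\<in>H. g (z n) = d" "\<not> e < norm (g (v k))"
          using ex unfolding bad_def by auto
        then show "\<exists>g\<in>C. (\<forall>n\<in>H. g (z n) = d) \<and> norm (g (v k)) \<le> e" by (auto simp: not_less)
      qed
      moreover have "M' \<subseteq> N" using M'(2) M(2) by simp
      ultimately have False using contr k M'(1) by (simp only: bex_simps) metis
      then show ?thesis ..
    next
      assume "\<exists>C\<in>\<C>. \<forall>L. infinite L \<and> L \<subseteq> M' \<longrightarrow> (\<exists>m. bad k C (L \<inter> {..<m}))"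
      then obtain C where "C \<in> \<C>" "barrier k C M'" unfolding barrier_def by (elim bexE)
      then show ?thesis using M'(1,2) by (intro exI[of _ M'] bexI[of _ C]) simp_all
    qed
  qed
  define q where "q = enumerate Q"
  have qQ: "q t \<in> Q" for t unfolding q_def by (rule enumerate_in_set[OF Q])
  have inj_q: "inj q" unfolding q_def by (rule strict_mono_imp_inj_on[OF strict_mono_enumerate[OF Q]])
  define ok where "ok t s \<longleftrightarrow> infinite (fst s) \<and> fst s \<subseteq> N \<and> snd s \<in> \<C> \<and> barrier (q t) (snd s) (fst s)"
    for t and s :: "nat set \<times> ('a \<Rightarrow> 'k) set"
  have "\<exists>h. \<forall>t. ok t (h t) \<and> fst (h (Suc t)) \<subseteq> fst (h t)"
  proof (rule dependent_nat_choice)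
    obtain M' C where "C \<in> \<C>" "infinite M'" "M' \<subseteq> N" "barrier (q 0) C M'"
      using step[OF qQ N] by blast
    then show "\<exists>s. ok 0 s" by (intro exI[of _ "(M', C)"]) (simp add: ok_def)
  next
    fix s t assume s: "ok t s"
    then obtain M' C where "C \<in> \<C>" "infinite M'" "M' \<subseteq> fst s" "barrier (q (Suc t)) C M'"
      using step[OF qQ, of "fst s" "Suc t"] unfolding ok_def by blast
    then show "\<exists>s'. ok (Suc t) s' \<and> fst s' \<subseteq> fst s"
      using s by (intro exI[of _ "(M', C)"]) (auto simp: ok_def)
  qed
  then obtain h where h: "\<And>t. ok t (h t)" "\<And>t. fst (h (Suc t)) \<subseteq> fst (h t)" by blast
  have hmono: "fst (h t') \<subseteq> fst (h t)" if "t \<le> t'" for t t'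
    using h(2) that by (rule lift_Suc_antimono_le)
  have "range (\<lambda>t. snd (h t)) \<subseteq> \<C>" using h(1) by (auto simp: ok_def)
  then obtain t\<^sub>0 where T: "infinite {t. snd (h t) = snd (h t\<^sub>0)}"
    using pigeonhole_infinite[of "UNIV :: nat set" "\<lambda>t. snd (h t)"] finite_subset[OF _ fin] by auto
  define C where "C = snd (h t\<^sub>0)"
  define T where "T = {t. snd (h t) = C}"
  have qT: "infinite (q ` T)"
    using T inj_on_subset[OF inj_q] unfolding T_def C_def by (simp add: finite_image_iff)
  obtain S where S: "finite S" "S \<subseteq> q ` T" "\<forall>f\<in>dual_ball. \<exists>k\<in>S. norm (f (v k)) \<le> e"
    by (rule finitely_many_large_values[OF v qT e])
  obtain T' where T': "T' \<subseteq> T" "finite T'" "S = q ` T'"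
    using finite_subset_image[OF S(1,2)] by auto
  \<comment> \<open>The dual ball is nonempty, so \<open>S\<close> is nonempty as well and the maxima below make sense.\<close>
  have ne: "T' \<noteq> {}" using bspec[OF S(3) norming_dual_ball[of 0]] T'(3) by auto
  \<comment> \<open>The last reservoir is contained in all the earlier ones, so it has bad initial segments for every \<open>t \<in> T'\<close>.\<close>
  define L where "L = fst (h (Max T'))"
  have L: "infinite L" using h(1) by (simp add: L_def ok_def)
  have "\<exists>m. bad (q t) C (L \<inter> {..<m})" if t: "t \<in> T'" for t
  proof -
    have "L \<subseteq> fst (h t)" unfolding L_def using t T'(2) by (intro hmono) simp
    moreover have "snd (h t) = C" using t T'(1) by (auto simp: T_def)
    ultimately show ?thesis using h(1)[of t] L unfolding ok_def barrier_def by auto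
  qed
  then obtain m where m: "\<And>t. t \<in> T' \<Longrightarrow> bad (q t) C (L \<inter> {..<m t})" by metis
  have "Max (m ` T') \<in> m ` T'" using ne T'(2) by simp
  then obtain t\<^sub>1 where t\<^sub>1: "t\<^sub>1 \<in> T'" "Max (m ` T') = m t\<^sub>1" by auto
  obtain g where g: "g \<in> C" "\<forall>n\<in>L \<inter> {..<m t\<^sub>1}. g (z n) = d"
    using m[OF t\<^sub>1(1)] unfolding bad_def by auto
  have "e < norm (g (v (q t)))" if t: "t \<in> T'" for t
  proof -
    have "m t \<le> m t\<^sub>1" using t T'(2) t\<^sub>1(2)[symmetric] by simp
    then have "\<forall>n\<in>L \<inter> {..<m t}. g (z n) = d" using g(2) by auto
    then show ?thesis using m[OF t] g(1) unfolding bad_def by auto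
  qed
  moreover have "g \<in> dual_ball"
    using g(1) ball[of C] h(1)[of t\<^sub>0] unfolding C_def ok_def by auto
  ultimately show False using S(3) T'(3) by fastforce
qed

text \<open>
  In the fusion, \<open>J\<close> consists of the pairs \<open>(\<rho> j, \<kappa> j)\<close> chosen so far and \<open>A \<subseteq> J\<close> is the pattern. The
  invariant says that a functional equal to \<open>d\<close> at the \<open>z n\<close> belonging to \<open>A\<close> and to a later finite
  set \<open>H\<close> can be replaced by one that nearly follows the pattern at all chosen \<open>u\<close> and is still
  exactly \<open>d\<close> on \<open>H\<close>. Keeping exact values on \<open>H\<close> prevents the errors from accumulating.

  To add an index \<open>n\<close>, the value at \<open>z n\<close> is first made small for patterns without \<open>n\<close>; then \<open>k\<close> is
  chosen so that the value at \<open>u n k - z n\<close> is small for all patterns.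
\<close>

lemma functionals_nearly_supported_on_pattern:
  fixes z :: "nat \<Rightarrow> 'a" and u :: "nat \<Rightarrow> nat \<Rightarrow> 'a"
  assumes z: "\<And>f. f \<in> dual_space smul \<Longrightarrow> (\<lambda>n. f (z n)) \<longlonglongrightarrow> 0"
    and u: "\<And>f n. f \<in> dual_space smul \<Longrightarrow> (\<lambda>k. f (u n k)) \<longlonglongrightarrow> f (z n)" and e: "0 < e"
  obtains \<rho> \<kappa> :: "nat \<Rightarrow> nat" where "strict_mono \<rho>"
    "\<forall>t F. F \<subseteq> {..<t} \<longrightarrow> (\<exists>f\<in>dual_ball. \<forall>j\<in>F. f (z (\<rho> j)) = d) \<longrightarrow>
      (\<exists>g\<in>dual_ball. \<forall>j<t. norm (g (u (\<rho> j) (\<kappa> j)) - (if j \<in> F then d else 0)) \<le> e)"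
proof -
  define near where "near J A = {g \<in> dual_ball.
      \<forall>p\<in>J. norm (g (u (fst p) (snd p)) - (if p \<in> A then d else 0)) \<le> e}"
    for J A :: "(nat \<times> nat) set"
  define Inv where "Inv J N \<longleftrightarrow> infinite N \<and> (\<forall>A\<subseteq>J. \<forall>H. finite H \<and> H \<subseteq> N \<longrightarrow>
      (\<exists>f\<in>dual_ball. \<forall>n\<in>fst ` A \<union> H. f (z n) = d) \<longrightarrow> (\<exists>g\<in>near J A. \<forall>n\<in>H. g (z n) = d))" for J N
  have near_ball: "near J A \<subseteq> dual_ball" for J A by (auto simp: near_def)
  have init: "Inv {} UNIV" by (auto simp: Inv_def near_def)
  have step: "\<exists>p N'. fst p \<in> N \<and> N' \<subseteq> N \<inter> {fst p<..} \<and> Inv (insert p J) N'"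
    if J: "finite J" and inv: "Inv J N" for J N
  proof -
    have N: "infinite N" using inv by (simp add: Inv_def)
    have invD: "\<exists>g\<in>near J A. \<forall>n\<in>H. g (z n) = d"
      if "A \<in> Pow J" "finite H \<and> H \<subseteq> N" "\<exists>f\<in>dual_ball. \<forall>n\<in>fst ` A \<union> H. f (z n) = d" for A H
      using inv that unfolding Inv_def by blast
    have e2: "0 < e / 2" using e by simp
    have finC: "finite (near J ` Pow J)" using J by simp
    have ballC: "C \<subseteq> dual_ball" if "C \<in> near J ` Pow J" for C using that near_ball by auto
    obtain n M where n: "n \<in> N" and M: "infinite M" "M \<subseteq> N" and
      M_small: "\<forall>C\<in>near J ` Pow J. \<forall>H. finite H \<and> H \<subseteq> M \<longrightarrow> (\<exists>g\<in>C. \<forall>n\<in>H. g (z n) = d) \<longrightarrow>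
        (\<exists>g\<in>C. (\<forall>n\<in>H. g (z n) = d) \<and> norm (g (z n)) \<le> e / 2)"
      using functional_values_can_be_made_small[where v = z and z = z and d = d, OF z N N e2 finC ballC] by auto
    \<comment> \<open>Patterns \<open>A\<close> of \<open>J\<close> that do not get the new index continue in \<open>small A\<close>, those that do continue in \<open>fixed A\<close>.\<close>
    define small where "small A = {g \<in> near J A. norm (g (z n)) \<le> e / 2}" for A
    define fixed where "fixed A = {g \<in> near J A. g (z n) = d}" for A
    have finD: "finite (small ` Pow J \<union> fixed ` Pow J)" using J by simp
    have ballD: "C \<subseteq> dual_ball" if "C \<in> small ` Pow J \<union> fixed ` Pow J" for C
      using that near_ball by (auto simp: small_def fixed_def)
    have "M \<subseteq> (M \<inter> {n<..}) \<union> {..n}" by auto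
    then have M': "infinite (M \<inter> {n<..})" using M(1) finite_subset by blast
    have un: "(\<lambda>k. f (u n k - z n)) \<longlonglongrightarrow> 0" if f: "f \<in> dual_space smul" for f
      using LIM_zero[OF u[OF f, of n]] by (simp add: linear_diff[OF dual_space_linear(1)[OF f]])
    obtain k M'' where M'': "infinite M''" "M'' \<subseteq> M \<inter> {n<..}" and
      M''_small: "\<forall>C\<in>small ` Pow J \<union> fixed ` Pow J. \<forall>H. finite H \<and> H \<subseteq> M'' \<longrightarrow>
        (\<exists>g\<in>C. \<forall>n\<in>H. g (z n) = d) \<longrightarrow>
        (\<exists>g\<in>C. (\<forall>n\<in>H. g (z n) = d) \<and> norm (g (u n k - z n)) \<le> e / 2)"
      using functional_values_can_be_made_small[where v = "\<lambda>k. u n k - z n" and z = z and d = d,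
          OF un infinite_UNIV_nat M' e2 finD ballD] by auto
    have "Inv (insert (n, k) J) M''"
      unfolding Inv_def
    proof (intro conjI allI impI M''(1))
      fix A H assume A: "A \<subseteq> insert (n, k) J" and H: "finite H \<and> H \<subseteq> M''"
        and "\<exists>f\<in>dual_ball. \<forall>n\<in>fst ` A \<union> H. f (z n) = d"
      then obtain f where f: "f \<in> dual_ball" "\<forall>n\<in>fst ` A \<union> H. f (z n) = d" by blast
      have HM: "H \<subseteq> M" and HN: "H \<subseteq> N" using H M''(2) M(2) by auto
      show "\<exists>g\<in>near (insert (n, k) J) A. \<forall>n\<in>H. g (z n) = d"
      proof (cases "(n, k) \<in> A")
        case True
        define A' where "A' = A - {(n, k)}"
        have A': "A' \<in> Pow J" using A by (auto simp: A'_def)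
        have "n \<in> fst ` A" using True by force
        then have "\<forall>n\<in>fst ` A' \<union> insert n H. f (z n) = d" using f(2) by (auto simp: A'_def)
        then have "\<exists>f\<in>dual_ball. \<forall>n\<in>fst ` A' \<union> insert n H. f (z n) = d" using f(1) by blast
        moreover have "finite (insert n H) \<and> insert n H \<subseteq> N" using H HN n by simp
        ultimately have "\<exists>g\<in>near J A'. \<forall>n\<in>insert n H. g (z n) = d"
          using invD[OF A'] by blast
        then have "\<exists>g\<in>fixed A'. \<forall>n\<in>H. g (z n) = d" by (auto simp: fixed_def)
        then obtain g where g: "g \<in> fixed A'" "\<forall>n\<in>H. g (z n) = d" "norm (g (u n k - z n)) \<le> e / 2"
          using M''_small[rule_format, of "fixed A'" H] A' H by auto
        have g_ball: "g \<in> dual_ball" using g(1) near_ball by (auto simp: fixed_def)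
        then have new: "norm (g (u n k) - d) \<le> e"
          using g(1,3) e by (simp add: fixed_def dual_ball_diff)
        have "norm (g (u (fst p) (snd p)) - (if p \<in> A then d else 0)) \<le> e"
          if p: "p \<in> insert (n, k) J" for p
        proof (cases "p = (n, k)")
          case False
          then have "p \<in> J" "p \<in> A' \<longleftrightarrow> p \<in> A" using p by (auto simp: A'_def)
          then show ?thesis using g(1) unfolding fixed_def near_def by auto
        qed (use new True in simp)
        then have "g \<in> near (insert (n, k) J) A"
          using g_ball unfolding near_def by blast
        then show ?thesis using g(2) by blast
      next
        case False
        then have A': "A \<in> Pow J" using A by auto
        have "\<exists>g\<in>near J A. \<forall>n\<in>H. g (z n) = d"
          using invD[OF A'] H HN f by blast
        then have "\<exists>g\<in>small A. \<forall>n\<in>H. g (z n) = d"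
          using M_small[rule_format, of "near J A" H] A' H HM by (auto simp: small_def)
        then obtain g where g: "g \<in> small A" "\<forall>n\<in>H. g (z n) = d" "norm (g (u n k - z n)) \<le> e / 2"
          using M''_small[rule_format, of "small A" H] A' H by auto
        have "g \<in> dual_ball" using g(1) near_ball by (auto simp: small_def)
        then have "norm (g (u n k)) \<le> e"
          using g(1,3) norm_triangle_ineq[of "g (u n k) - g (z n)" "g (z n)"]
          by (simp add: small_def dual_ball_diff)
        then have "g \<in> near (insert (n, k) J) A"
          using g(1) False by (auto simp: small_def near_def)
        then show ?thesis using g(2) by blast
      qed
    qed
    then show ?thesis using n M''(2) M(2) by (intro exI[of _ "(n, k)"] exI[of _ M'']) auto
  qed
  from fusion_sequence[of Inv UNIV fst, OF init step]
  obtain q :: "nat \<Rightarrow> nat \<times> nat" and N :: "nat \<Rightarrow> nat set" where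
    q: "strict_mono (\<lambda>t. fst (q t))" and inv: "\<And>t. Inv (q ` {..<t}) (N t)"
    by blast
  have inj: "inj q" using strict_mono_eq[OF q] by (intro injI) metis
  show ?thesis
  proof (rule that[of "\<lambda>t. fst (q t)" "\<lambda>t. snd (q t)"])
    show "strict_mono (\<lambda>t. fst (q t))" by (rule q)
    show "\<forall>t F. F \<subseteq> {..<t} \<longrightarrow> (\<exists>f\<in>dual_ball. \<forall>j\<in>F. f (z (fst (q j))) = d) \<longrightarrow>
      (\<exists>g\<in>dual_ball. \<forall>j<t. norm (g (u (fst (q j)) (snd (q j))) - (if j \<in> F then d else 0)) \<le> e)"
    proof (intro allI impI)
      fix t F assume F: "F \<subseteq> {..<t}" and "\<exists>f\<in>dual_ball. \<forall>j\<in>F. f (z (fst (q j))) = d"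
      then have "\<exists>f\<in>dual_ball. \<forall>n\<in>fst ` (q ` F) \<union> {}. f (z n) = d" by auto
      moreover have "q ` F \<subseteq> q ` {..<t}" using F by auto
      ultimately obtain g where g: "g \<in> near (q ` {..<t}) (q ` F)"
        using inv[of t] unfolding Inv_def by (metis empty_subsetI finite.emptyI)
      have "norm (g (u (fst (q j)) (snd (q j))) - (if j \<in> F then d else 0)) \<le> e" if "j < t" for j
      proof -
        have "q j \<in> q ` {..<t}" using that by simp
        then have "norm (g (u (fst (q j)) (snd (q j))) - (if q j \<in> q ` F then d else 0)) \<le> e"
          using g unfolding near_def by blast
        then show ?thesis by (simp only: inj_image_mem_iff[OF inj])
      qed
      then show "\<exists>g\<in>dual_ball. \<forall>j<t. norm (g (u (fst (q j)) (snd (q j))) - (if j \<in> F then d else 0)) \<le> e"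
        using g near_ball by blast
    qed
  qed
qed

end

section \<open>Spreading models along diagonal sequences and the equivalence\<close>

lemma schreier_finite: "E \<in> schreier \<phi> \<xi> \<Longrightarrow> finite E"
proof -
  have "(\<xi>, E) \<in> schreier_rel \<phi> \<Longrightarrow> finite E"
    by (induction rule: schreier_rel.induct[split_format(complete)]) auto
  then show "E \<in> schreier \<phi> \<xi> \<Longrightarrow> finite E" by (simp add: schreier_def)
qed

text \<open>
  Moving the elements of a set to the right preserves membership, since the constraints in the
  definition bound numbers of sets by minima.
\<close>

lemma schreier_spreading:
  assumes s: "strict_mono (s :: nat \<Rightarrow> nat)" and E: "E \<in> schreier \<phi> \<xi>"
  shows "s ` E \<in> schreier \<phi> \<xi>"
proof -
  have le: "m \<le> s m" for m using s by (rule strict_mono_imp_increasing)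
  have "(\<xi>, E) \<in> schreier_rel \<phi> \<Longrightarrow> (\<xi>, s ` E) \<in> schreier_rel \<phi>"
  proof (induction rule: schreier_rel.induct[split_format(complete)])
    case (zero_singleton n)
    then show ?case using le[of n] by (auto intro!: schreier_rel.zero_singleton)
  next
    case (succ_union n E \<xi>)
    have fin: "finite (E 1)"
      using succ_union.hyps(3)[of 1] succ_union.hyps(1) schreier_finite[of "E 1" \<phi> \<xi>] by (simp add: schreier_def)
    have "s (Min (E 1)) \<le> Min (s ` E 1)"
      using mono_Min_commute[OF strict_mono_mono[OF s] fin] succ_union.hyps(1) succ_union.hyps(2)[of 1] by simp
    then have "n \<le> Min (s ` E 1)" using succ_union.hyps(5) le[of "Min (E 1)"] by linarith
    moreover have "set_before (s ` E i) (s ` E (Suc i))" if "i \<in> {1..<n}" for i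
      using succ_union.hyps(4)[OF that] s by (auto simp: set_before_def strict_mono_def)
    ultimately have "(ord_succ \<xi>, \<Union>i\<in>{1..n}. s ` E i) \<in> schreier_rel \<phi>"
      using succ_union.hyps(1,2) succ_union.IH by (intro schreier_rel.succ_union) auto
    then show ?case by (simp add: image_UN)
  next
    case (limit \<xi> n E)
    show ?case
    proof (rule schreier_rel.limit[OF limit.hyps(1,2) _ limit.IH])
      fix m assume "m \<in> s ` E"
      then show "n \<le> m" using limit.hyps(3) le order_trans by blast
    qed
  qed (auto intro: schreier_rel.intros)
  then show ?thesis using E by (simp add: schreier_def)
qed

lemma l1_spreading_modelD:
  assumes "l1_spreading_model smul \<phi> \<xi> x"
  obtains c where "0 < c" "\<forall>E a. E \<in> schreier \<phi> \<xi> \<longrightarrow> (\<Sum>n\<in>E. norm (a n)) = 1 \<longrightarrow>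
    c \<le> norm (\<Sum>n\<in>E. smul (a n) (x n))"
proof -
  let ?S = "{norm (\<Sum>n\<in>E. smul (a n) (x n)) | E a. E \<in> schreier \<phi> \<xi> \<and> (\<Sum>n\<in>E. norm (a n)) = 1}"
  have "bdd_below ?S" by (rule bdd_belowI[of _ 0]) auto
  then have "Inf ?S \<le> norm (\<Sum>n\<in>E. smul (a n) (x n))"
    if "E \<in> schreier \<phi> \<xi>" "(\<Sum>n\<in>E. norm (a n)) = 1" for E a
    using that by (intro cInf_lower) auto
  moreover have "0 < Inf ?S" using assms by (simp add: l1_spreading_model_def)
  ultimately show ?thesis by (intro that[of "Inf ?S"]) auto
qed

text \<open>
  The second spreading model \<open>z\<close> excludes a degenerate case. The infimum of the empty set of reals is
  an unspecified number; but whether the set of norms is empty does not depend on the sequence, so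
  in that case \<open>x\<close> and \<open>z\<close> have the same infimum.
\<close>

lemma l1_spreading_modelI:
  fixes smul :: "'k::real_normed_field \<Rightarrow> 'a::banach \<Rightarrow> 'a"
  assumes z: "l1_spreading_model smul \<phi> \<xi> z" and c: "0 < c"
    and est: "\<And>E a. E \<in> schreier \<phi> \<xi> \<Longrightarrow> (\<Sum>n\<in>E. norm (a n)) = 1 \<Longrightarrow>
      c \<le> norm (\<Sum>n\<in>E. smul (a n) (x n))"
  shows "l1_spreading_model smul \<phi> \<xi> x"
proof -
  define S where "S y = {norm (\<Sum>n\<in>E. smul (a n) (y n)) | E a.
    E \<in> schreier \<phi> \<xi> \<and> (\<Sum>n\<in>E. norm (a n)) = 1}" for y
  have "0 < Inf (S x)"
  proof (cases "S x = {}")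
    case True
    then have "S z = S x" by (auto simp: S_def)
    moreover have "0 < Inf (S z)" using z unfolding l1_spreading_model_def S_def .
    ultimately show ?thesis by simp
  next
    case False
    then have "c \<le> Inf (S x)" by (rule cInf_greatest) (use est in \<open>auto simp: S_def\<close>)
    then show ?thesis using c by simp
  qed
  then show ?thesis unfolding l1_spreading_model_def S_def .
qed

context banach_scalars
begin

lemma lower_l1_estimate_scaled:
  fixes x :: "nat \<Rightarrow> 'a" and a :: "nat \<Rightarrow> 'k"
  assumes c: "\<And>b. (\<Sum>n\<in>E. norm (b n)) = 1 \<Longrightarrow> c \<le> norm (\<Sum>n\<in>E. smul (b n) (x n))"
  shows "c * (\<Sum>n\<in>E. norm (a n)) \<le> norm (\<Sum>n\<in>E. smul (a n) (x n))"
proof (cases "(\<Sum>n\<in>E. norm (a n)) = 0")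
  case False
  define A where "A = (\<Sum>n\<in>E. norm (a n))"
  have A: "0 < A" using False unfolding A_def by (simp add: less_le sum_nonneg)
  have "(\<Sum>n\<in>E. norm ((1 / A) *\<^sub>R a n)) = 1"
    using A by (simp add: A_def flip: sum_divide_distrib)
  then have "c \<le> norm (\<Sum>n\<in>E. smul ((1 / A) *\<^sub>R a n) (x n))" by (rule c)
  also have "\<dots> = norm ((1 / A) *\<^sub>R (\<Sum>n\<in>E. smul (a n) (x n)))"
    by (simp only: linear_scale[OF linear_smul_left] scaleR_sum_right)
  also have "\<dots> = norm (\<Sum>n\<in>E. smul (a n) (x n)) / A" using A by simp
  finally show ?thesis using A by (simp add: A_def field_simps)
qed simp

text \<open>
  The functional returns \<open>d\<close> times the partial sum over \<open>F\<close>, which is at least \<open>d / 4\<close>, up to an error of \<open>d / 8\<close>.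
\<close>

lemma lower_l1_estimate_of_functional:
  fixes w :: "nat \<Rightarrow> 'a" and a :: "nat \<Rightarrow> 'k"
  assumes E: "finite E" and F: "F \<subseteq> E" and g: "g \<in> dual_ball" and d: "0 \<le> d"
    and a: "(\<Sum>n\<in>E. norm (a n)) = 1" "1 \<le> 4 * norm (\<Sum>n\<in>F. a n)"
    and near: "\<And>n. n \<in> E \<Longrightarrow> norm (g (w n) - (if n \<in> F then of_real d else 0)) \<le> d / 8"
  shows "d / 8 \<le> norm (\<Sum>n\<in>E. smul (a n) (w n))"
proof -
  let ?p = "\<lambda>n. if n \<in> F then of_real d else (0 :: 'k)"
  have g_sum: "g (\<Sum>n\<in>E. smul (a n) (w n)) = (\<Sum>n\<in>E. a n * g (w n))"
    using dual_space_linear[OF dual_ball_dual_space[OF g]] by (simp add: linear_sum)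
  have "(\<Sum>n\<in>E. a n * ?p n) = (\<Sum>n\<in>F. a n) * of_real d"
    using E F by (simp add: sum_distrib_right sum.If_cases if_distrib[of "\<lambda>x. _ * x"] Int_absorb1
        Int_def[symmetric] cong: if_cong)
  then have main: "norm (\<Sum>n\<in>E. a n * ?p n) = d * norm (\<Sum>n\<in>F. a n)"
    using d by (simp add: norm_mult)
  have "norm ((\<Sum>n\<in>E. a n * g (w n)) - (\<Sum>n\<in>E. a n * ?p n)) = norm (\<Sum>n\<in>E. a n * (g (w n) - ?p n))"
    by (simp add: sum_subtractf right_diff_distrib)
  also have "\<dots> \<le> (\<Sum>n\<in>E. norm (a n) * (d / 8))"
  proof (rule sum_norm_le)
    fix n assume "n \<in> E"
    then show "norm (a n * (g (w n) - ?p n)) \<le> norm (a n) * (d / 8)"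
      unfolding norm_mult by (intro mult_left_mono near norm_ge_zero)
  qed
  also have "\<dots> = d / 8" using a(1) by (simp flip: sum_distrib_right sum_divide_distrib)
  finally have "d * norm (\<Sum>n\<in>F. a n) - d / 8 \<le> norm (g (\<Sum>n\<in>E. smul (a n) (w n)))"
    using main g_sum norm_triangle_ineq3[of "\<Sum>n\<in>E. a n * g (w n)" "\<Sum>n\<in>E. a n * ?p n"] by simp
  also have "\<dots> \<le> norm (\<Sum>n\<in>E. smul (a n) (w n))" by (rule norm_dual_ball[OF g])
  finally show ?thesis using mult_left_mono[OF a(2) d] by simp
qed

text \<open>
  A lower estimate on a Schreier set provides functionals equal to \<open>c\<close> at all its \<open>z n\<close>, hence on every
  subset \<open>F\<close>, and they are transferred to the diagonal sequence. The Schreier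
  set needed for \<open>E\<close> is its image under \<open>\<rho> \<circ> s\<close>.
\<close>

lemma diagonal_spreading_model:
  fixes z :: "nat \<Rightarrow> 'a" and u :: "nat \<Rightarrow> nat \<Rightarrow> 'a"
  assumes z: "\<And>f. f \<in> dual_space smul \<Longrightarrow> (\<lambda>n. f (z n)) \<longlonglongrightarrow> 0"
    and u: "\<And>f n. f \<in> dual_space smul \<Longrightarrow> (\<lambda>k. f (u n k)) \<longlonglongrightarrow> f (z n)"
    and l1: "l1_spreading_model smul \<phi> \<xi> z"
  obtains \<rho> \<kappa> :: "nat \<Rightarrow> nat" where "strict_mono \<rho>"
    "\<forall>s. strict_mono s \<longrightarrow> l1_spreading_model smul \<phi> \<xi> (\<lambda>j. u (\<rho> (s j)) (\<kappa> (s j)))"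
proof -
  obtain c where c: "0 < c" and est: "\<forall>E a. E \<in> schreier \<phi> \<xi> \<longrightarrow> (\<Sum>n\<in>E. norm (a n)) = 1 \<longrightarrow>
    c \<le> norm (\<Sum>n\<in>E. smul (a n) (z n))"
    by (rule l1_spreading_modelD[OF l1])
  have c8: "0 < c / 8" using c by simp
  obtain \<rho> \<kappa> :: "nat \<Rightarrow> nat" where \<rho>: "strict_mono \<rho>" and pattern:
    "\<forall>t F. F \<subseteq> {..<t} \<longrightarrow> (\<exists>f\<in>dual_ball. \<forall>j\<in>F. f (z (\<rho> j)) = of_real c) \<longrightarrow>
      (\<exists>g\<in>dual_ball. \<forall>j<t. norm (g (u (\<rho> j) (\<kappa> j)) - (if j \<in> F then of_real c else 0)) \<le> c / 8)"
    by (rule functionals_nearly_supported_on_pattern[OF z u c8])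
  have "l1_spreading_model smul \<phi> \<xi> (\<lambda>j. u (\<rho> (s j)) (\<kappa> (s j)))" if s: "strict_mono s" for s
  proof (rule l1_spreading_modelI[OF l1 c8])
    fix E and a :: "nat \<Rightarrow> 'k" assume E: "E \<in> schreier \<phi> \<xi>" and a: "(\<Sum>n\<in>E. norm (a n)) = 1"
    have fin: "finite E" by (rule schreier_finite[OF E])
    obtain F where F: "F \<subseteq> E" "1 \<le> 4 * norm (\<Sum>n\<in>F. a n)"
      using large_partial_sum[OF fin, of a] a by auto
    have "(\<lambda>n. \<rho> (s n)) ` E \<in> schreier \<phi> \<xi>"
      using schreier_spreading[OF \<rho> schreier_spreading[OF s E]] by (simp add: image_image)
    then have "c * (\<Sum>n\<in>(\<lambda>n. \<rho> (s n)) ` E. norm (b n)) \<le> norm (\<Sum>n\<in>(\<lambda>n. \<rho> (s n)) ` E. smul (b n) (z n))" for b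
      using est by (intro lower_l1_estimate_scaled) blast
    then obtain f where f: "f \<in> dual_ball" "\<And>n. n \<in> (\<lambda>n. \<rho> (s n)) ` E \<Longrightarrow> f (z n) = of_real c"
      using interpolating_functional[of "(\<lambda>n. \<rho> (s n)) ` E" c z] fin c by auto
    have "finite (s ` E)" using fin by simp
    then obtain t where t: "s ` E \<subseteq> {..<t}" unfolding finite_nat_iff_bounded by blast
    have "s ` F \<subseteq> {..<t}" using t F(1) by auto
    moreover have "\<exists>f\<in>dual_ball. \<forall>j\<in>s ` F. f (z (\<rho> j)) = of_real c"
      using f F(1) by (intro bexI[of _ f]) auto
    ultimately have "\<exists>g\<in>dual_ball. \<forall>j<t.
        norm (g (u (\<rho> j) (\<kappa> j)) - (if j \<in> s ` F then of_real c else 0)) \<le> c / 8"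
      by (rule pattern[THEN spec, THEN spec, THEN mp, THEN mp])
    then obtain g where g: "g \<in> dual_ball"
      "\<forall>j<t. norm (g (u (\<rho> j) (\<kappa> j)) - (if j \<in> s ` F then of_real c else 0)) \<le> c / 8"
      by (elim bexE)
    show "c / 8 \<le> norm (\<Sum>n\<in>E. smul (a n) (u (\<rho> (s n)) (\<kappa> (s n))))"
    proof (rule lower_l1_estimate_of_functional[OF fin F(1) g(1) _ a F(2)])
      fix n assume n: "n \<in> E"
      have "s n \<in> s ` F \<longleftrightarrow> n \<in> F" by (rule inj_image_mem_iff[OF strict_mono_imp_inj_on[OF s]])
      moreover have "s n < t" using n t by auto
      ultimately show "norm (g (u (\<rho> (s n)) (\<kappa> (s n))) - (if n \<in> F then of_real c else 0)) \<le> c / 8"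
        using g(2)[rule_format, of "s n"] by simp
    qed (use c in simp)
  qed
  then show ?thesis using that[OF \<rho>] by blast
qed

lemma weak_limit_unique:
  assumes "weakly_convergent smul x l" "weakly_convergent smul x l'"
  shows "l = l'"
proof -
  let ?f = "norming (l - l')"
  have "?f l = ?f l'"
    using assms dual_ball_dual_space[OF norming_dual_ball] LIMSEQ_unique
    unfolding weakly_convergent_iff by blast
  then have "norm (l - l') = 0"
    using norm_norming[of "l - l'"] by (simp add: dual_ball_diff[OF norming_dual_ball])
  then show ?thesis by simp
qed

lemma weakly_convergent_if_convergent: "x \<longlonglongrightarrow> l \<Longrightarrow> weakly_convergent smul x l"
  unfolding weakly_convergent_iff dual_space_def using bounded_linear.tendsto by blast

lemma weakly_convergent_if_xi_weakly_convergent: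
  "xi_weakly_convergent smul \<phi> \<xi> x l \<Longrightarrow> weakly_convergent smul x l"
  by (auto simp: xi_weakly_convergent_def weakly_convergent_if_convergent split: if_splits)

lemma weakly_sequentially_precompact_if_xi:
  assumes "xi_weakly_precompact smul \<phi> \<xi> K"
  shows "weakly_sequentially_precompact K"
  unfolding weakly_sequentially_precompact_def
proof (intro allI impI)
  fix y :: "nat \<Rightarrow> 'a" assume "\<forall>n. y n \<in> K"
  then obtain r l where "strict_mono r" "xi_weakly_convergent smul \<phi> \<xi> (y \<circ> r) l"
    using assms unfolding xi_weakly_precompact_def by blast
  then show "\<exists>r l. strict_mono r \<and> weakly_convergent smul (y \<circ> r) l"
    using weakly_convergent_if_xi_weakly_convergent by blast
qed

text \<open>
  A sequence in \<open>K\<close> that converges weakly to \<open>x n\<close> has a norm convergent subsequence, so \<open>x n\<close> is a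
  norm limit of points of \<open>K\<close>.
\<close>

lemma weak_closure_norm_sequentially_compact:
  fixes x :: "nat \<Rightarrow> 'a"
  assumes K: "xi_weakly_precompact smul \<phi> 0 K" and x: "\<And>n. x n \<in> weak_topology smul closure_of K"
  shows "\<exists>r l. strict_mono r \<and> (x \<circ> r) \<longlonglongrightarrow> l"
proof -
  have pick: "\<exists>r l. strict_mono r \<and> (y \<circ> r) \<longlonglongrightarrow> l" if "\<And>n. y n \<in> K"
    for y :: "nat \<Rightarrow> 'a"
    using K[unfolded xi_weakly_precompact_def, rule_format, of y] that
    by (simp add: xi_weakly_convergent_def)
  have "\<exists>v\<in>K. dist v (x n) < 1 / real (Suc n)" for n
  proof -
    obtain y where y: "\<And>k. y k \<in> K" "weakly_convergent smul y (x n)"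
      using weak_closure_point_is_sequential_limit[OF weakly_sequentially_precompact_if_xi[OF K] x[of n]]
      by blast
    obtain r l where r: "strict_mono r" and l: "(y \<circ> r) \<longlonglongrightarrow> l" using pick[of y, OF y(1)] by blast
    have "l = x n"
      by (rule weak_limit_unique[OF weakly_convergent_if_convergent[OF l] weakly_convergent_subseq[OF y(2) r]])
    then have "eventually (\<lambda>k. dist ((y \<circ> r) k) (x n) < 1 / real (Suc n)) sequentially"
      using tendstoD[OF l, of "1 / real (Suc n)"] by simp
    then show ?thesis using y(1) unfolding eventually_sequentially by auto
  qed
  then obtain v where v: "\<And>n. v n \<in> K" "\<And>n. dist (v n) (x n) < 1 / real (Suc n)" by metis
  obtain r l where r: "strict_mono r" and l: "(v \<circ> r) \<longlonglongrightarrow> l" using pick[of v, OF v(1)] by blast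
  have "(\<lambda>n. v n - x n) \<longlonglongrightarrow> 0"
    by (rule Lim_null_comparison[OF always_eventually LIMSEQ_Suc[OF lim_1_over_n]])
      (use v(2) less_imp_le in \<open>auto simp: dist_norm\<close>)
  from tendsto_diff[OF l LIMSEQ_subseq_LIMSEQ[OF this r]]
  have "(x \<circ> r) \<longlonglongrightarrow> l" by (simp add: o_def)
  then show ?thesis using r by blast
qed

text \<open>
  A weakly convergent subsequence with limit \<open>l\<close> is even \<open>\<xi>\<close>-weakly convergent: a spreading model inside it
  would yield one along a sequence in \<open>K\<close> all of whose subsequences are spreading
  models too, while one of them must be \<open>\<xi>\<close>-weakly convergent, necessarily to \<open>l\<close>.
\<close>

lemma weak_closure_xi_sequentially_compact:
  fixes x :: "nat \<Rightarrow> 'a"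
  assumes K: "xi_weakly_precompact smul \<phi> \<xi> K" and \<xi>: "\<xi> \<noteq> 0" "\<xi> < omega1"
    and x: "\<And>n. x n \<in> weak_topology smul closure_of K"
  shows "\<exists>r l. strict_mono r \<and> xi_weakly_convergent smul \<phi> \<xi> (x \<circ> r) l"
proof -
  note wK = weakly_sequentially_precompact_if_xi[OF K]
  obtain r\<^sub>0 l where r\<^sub>0: "strict_mono r\<^sub>0" and l: "weakly_convergent smul (x \<circ> r\<^sub>0) l"
    by (rule weak_closure_sequentially_precompact[of K x, OF wK x])
  have "xi_weakly_convergent smul \<phi> \<xi> (x \<circ> r\<^sub>0) l"
  proof (rule ccontr)
    assume "\<not> ?thesis"
    then obtain r where r: "strict_mono r" and l1: "l1_spreading_model smul \<phi> \<xi> (\<lambda>n. (x \<circ> r\<^sub>0) (r n) - l)"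
      using \<xi> l unfolding xi_weakly_convergent_def by auto
    define X where "X n = x (r\<^sub>0 (r n))" for n
    have X: "weakly_convergent smul X l"
      using weakly_convergent_subseq[OF l r] by (simp add: X_def[abs_def] o_def)
    obtain y where yK: "\<And>n k. y n k \<in> K" and yX: "\<And>n. weakly_convergent smul (y n) (X n)"
      and diag: "\<And>r (\<kappa> :: nat \<Rightarrow> nat) l'. strict_mono r \<Longrightarrow>
        weakly_convergent smul (\<lambda>j. y (r j) (\<kappa> j)) l' \<Longrightarrow> l' = l"
      using diagonal_sequences_same_limit[OF wK _ X] x unfolding X_def by blast
    have zlim: "(\<lambda>n. f (X n - l)) \<longlonglongrightarrow> 0" if f: "f \<in> dual_space smul" for f
      using LIM_zero[OF weakly_convergentD[OF X f]] by (simp add: linear_diff[OF dual_space_linear(1)[OF f]])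
    have ulim: "(\<lambda>k. f (y n k - l)) \<longlonglongrightarrow> f (X n - l)" if f: "f \<in> dual_space smul" for f n
      using tendsto_diff[OF weakly_convergentD[OF yX f] tendsto_const]
      by (simp add: linear_diff[OF dual_space_linear(1)[OF f]])
    have l1': "l1_spreading_model smul \<phi> \<xi> (\<lambda>n. X n - l)" using l1 by (simp add: X_def)
    obtain \<rho> \<kappa> :: "nat \<Rightarrow> nat" where \<rho>: "strict_mono \<rho>" and
      spread: "\<forall>s. strict_mono s \<longrightarrow> l1_spreading_model smul \<phi> \<xi> (\<lambda>j. y (\<rho> (s j)) (\<kappa> (s j)) - l)"
      by (rule diagonal_spreading_model[where u = "\<lambda>n k. y n k - l", OF zlim ulim l1'])
    obtain s l' where s: "strict_mono s"
      and conv: "xi_weakly_convergent smul \<phi> \<xi> ((\<lambda>j. y (\<rho> j) (\<kappa> j)) \<circ> s) l'"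
      using K[unfolded xi_weakly_precompact_def, rule_format, of "\<lambda>j. y (\<rho> j) (\<kappa> j)"] yK by blast
    have "l' = l"
      using diag[of "\<rho> \<circ> s" "\<kappa> \<circ> s" l'] strict_mono_o[OF \<rho> s]
        weakly_convergent_if_xi_weakly_convergent[OF conv] by (simp add: o_def)
    then have "\<not> l1_spreading_model smul \<phi> \<xi> (\<lambda>j. y (\<rho> (s j)) (\<kappa> (s j)) - l)"
      using conv \<xi> unfolding xi_weakly_convergent_def
      by (auto dest!: spec[of _ "\<lambda>n. n"] simp: strict_mono_def)
    then show False using spread s by blast
  qed
  then show ?thesis using r\<^sub>0 by blast
qed

theorem xi_weakly_precompact_iff_weak_closure_xi_weakly_compact:
  "xi_weakly_precompact smul \<phi> \<xi> K \<longleftrightarrow>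
    xi_weakly_compact smul \<phi> \<xi> (weak_topology smul closure_of K)"
proof
  assume compact: "xi_weakly_compact smul \<phi> \<xi> (weak_topology smul closure_of K)"
  have "K \<subseteq> weak_topology smul closure_of K" by (rule closure_of_subset) simp
  then show "xi_weakly_precompact smul \<phi> \<xi> K"
    using compact unfolding xi_weakly_compact_def xi_weakly_precompact_def by blast
next
  assume K: "xi_weakly_precompact smul \<phi> \<xi> K"
  have sub: "\<exists>r l. strict_mono r \<and> xi_weakly_convergent smul \<phi> \<xi> (x \<circ> r) l"
    if x: "\<And>n. x n \<in> weak_topology smul closure_of K" for x :: "nat \<Rightarrow> 'a"
  proof -
    consider "\<xi> = 0" | "\<xi> \<noteq> 0" "\<xi> < omega1" | "\<xi> \<noteq> 0" "\<not> \<xi> < omega1" by blast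
    then show ?thesis
    proof cases
      case 1
      then show ?thesis
        using weak_closure_norm_sequentially_compact[of \<phi> K x] K x by (simp add: xi_weakly_convergent_def)
    next
      case 2
      then show ?thesis using weak_closure_xi_sequentially_compact[of \<phi> \<xi> K x] K x by simp
    next
      case 3
      obtain r l where "strict_mono r" "weakly_convergent smul (x \<circ> r) l"
        by (rule weak_closure_sequentially_precompact[of K x, OF weakly_sequentially_precompact_if_xi[OF K] x])
      with 3 show ?thesis unfolding xi_weakly_convergent_def by auto
    qed
  qed
  show "xi_weakly_compact smul \<phi> \<xi> (weak_topology smul closure_of K)"
    unfolding xi_weakly_compact_def
  proof (intro allI impI)
    fix x :: "nat \<Rightarrow> 'a" assume x: "\<forall>n\<ge>1. x n \<in> weak_topology smul closure_of K"
    \<comment> \<open>Only the terms \<open>x n\<close> with \<open>n \<ge> 1\<close> are known to lie in the weak closure.\<close>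
    then have x': "(x \<circ> Suc) n \<in> weak_topology smul closure_of K" for n by simp
    obtain r l where r: "strict_mono r" and l: "xi_weakly_convergent smul \<phi> \<xi> (x \<circ> (Suc \<circ> r)) l"
      using sub[of "x \<circ> Suc", OF x'] by (auto simp: o_assoc)
    have "l \<in> weak_topology smul closure_of K"
      using weak_limit_in_weak_closure[OF weakly_convergent_if_xi_weakly_convergent[OF l]] x by simp
    moreover have "strict_mono (Suc \<circ> r)" using r by (simp add: strict_mono_def)
    ultimately show "\<exists>r. \<exists>l\<in>weak_topology smul closure_of K. strict_mono r \<and>
        xi_weakly_convergent smul \<phi> \<xi> (x \<circ> r) l"
      using l by (intro exI[of _ "Suc \<circ> r"] bexI[of _ l]) simp_all
  qed
qed

end

section \<open>The two scalar fields\<close>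

lemma real_large_partial_sum:
  fixes a :: "'i \<Rightarrow> real"
  assumes "finite E"
  shows "\<exists>F\<subseteq>E. (\<Sum>n\<in>E. \<bar>a n\<bar>) \<le> 2 * \<bar>\<Sum>n\<in>F. a n\<bar>"
proof -
  define P where "P = {n \<in> E. 0 \<le> a n}"
  have "(\<Sum>n\<in>E. \<bar>a n\<bar>) = (\<Sum>n\<in>P. \<bar>a n\<bar>) + (\<Sum>n\<in>E - P. \<bar>a n\<bar>)"
    using assms by (subst add.commute, intro sum.subset_diff) (auto simp: P_def)
  also have "(\<Sum>n\<in>P. \<bar>a n\<bar>) = (\<Sum>n\<in>P. a n)" by (rule sum.cong) (auto simp: P_def)
  also have "(\<Sum>n\<in>E - P. \<bar>a n\<bar>) = (\<Sum>n\<in>E - P. - a n)" by (rule sum.cong) (auto simp: P_def)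
  finally have "(\<Sum>n\<in>E. \<bar>a n\<bar>) \<le> \<bar>\<Sum>n\<in>P. a n\<bar> + \<bar>\<Sum>n\<in>E - P. a n\<bar>"
    by (simp add: sum_negf)
  then have "(\<Sum>n\<in>E. \<bar>a n\<bar>) \<le> 2 * \<bar>\<Sum>n\<in>P. a n\<bar> \<or> (\<Sum>n\<in>E. \<bar>a n\<bar>) \<le> 2 * \<bar>\<Sum>n\<in>E - P. a n\<bar>"
    by linarith
  moreover have "P \<subseteq> E" "E - P \<subseteq> E" by (auto simp: P_def)
  ultimately show ?thesis by blast
qed

lemma complex_large_partial_sum:
  fixes a :: "'i \<Rightarrow> complex"
  assumes "finite E"
  shows "\<exists>F\<subseteq>E. (\<Sum>n\<in>E. norm (a n)) \<le> 4 * norm (\<Sum>n\<in>F. a n)"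
proof -
  obtain F where F: "F \<subseteq> E" "(\<Sum>n\<in>E. \<bar>Re (a n)\<bar>) \<le> 2 * \<bar>\<Sum>n\<in>F. Re (a n)\<bar>"
    using real_large_partial_sum[OF assms, of "\<lambda>n. Re (a n)"] by (elim exE conjE)
  obtain G where G: "G \<subseteq> E" "(\<Sum>n\<in>E. \<bar>Im (a n)\<bar>) \<le> 2 * \<bar>\<Sum>n\<in>G. Im (a n)\<bar>"
    using real_large_partial_sum[OF assms, of "\<lambda>n. Im (a n)"] by (elim exE conjE)
  have "(\<Sum>n\<in>E. norm (a n)) \<le> (\<Sum>n\<in>E. \<bar>Re (a n)\<bar> + \<bar>Im (a n)\<bar>)"
    by (rule sum_mono) (rule cmod_le)
  then have "(\<Sum>n\<in>E. norm (a n)) \<le> 2 * norm (\<Sum>n\<in>F. a n) + 2 * norm (\<Sum>n\<in>G. a n)"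
    using F(2) G(2) abs_Re_le_cmod[of "\<Sum>n\<in>F. a n"] abs_Im_le_cmod[of "\<Sum>n\<in>G. a n"]
    by (simp add: sum.distrib)
  then have "(\<Sum>n\<in>E. norm (a n)) \<le> 4 * norm (\<Sum>n\<in>F. a n) \<or>
      (\<Sum>n\<in>E. norm (a n)) \<le> 4 * norm (\<Sum>n\<in>G. a n)" by linarith
  then show ?thesis using F(1) G(1) by blast
qed

lemma banach_scalars_real: "banach_scalars ((*\<^sub>R) :: real \<Rightarrow> 'a::banach \<Rightarrow> 'a) (\<lambda>c. c)"
proof (rule banach_scalars.intro)
  fix x :: 'a
  show "linear (\<lambda>c :: real. c *\<^sub>R x)" by (intro linearI) (simp_all add: scaleR_add_left)
next
  show "linear (\<lambda>c :: real. c)" by (intro linearI) simp_all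
next
  fix d :: real assume "\<And>c. c * d \<le> 0"
  from this[of d] show "d = 0" by (auto simp: mult_le_0_iff)
next
  fix F :: "'a \<Rightarrow> real" assume F: "linear F" "\<And>x. F x \<le> norm x"
  have "norm (F x) \<le> norm x" for x
    using F(2)[of x] F(2)[of "- x"] linear_neg[OF F(1), of x] by simp
  moreover from this have "F \<in> dual_space (*\<^sub>R)"
    unfolding dual_space_def
    by (simp add: linear_scale[OF F(1)] bounded_linear_intro[of F 1] linear_add[OF F(1)])
  ultimately show "\<exists>G\<in>dual_space (*\<^sub>R). \<forall>x. norm (G x) \<le> norm x \<and> G x = F x" by blast
next
  fix E :: "nat set" and a :: "nat \<Rightarrow> real" assume E: "finite E"
  obtain F where F: "F \<subseteq> E" "(\<Sum>n\<in>E. \<bar>a n\<bar>) \<le> 2 * \<bar>\<Sum>n\<in>F. a n\<bar>"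
    using real_large_partial_sum[OF E, of a] by (elim exE conjE)
  then show "\<exists>F\<subseteq>E. (\<Sum>n\<in>E. norm (a n)) \<le> 4 * norm (\<Sum>n\<in>F. a n)"
    by (intro exI[of _ F]) auto
qed simp

lemma scaleC_minus_one: "(-1) *\<^sub>C x = - (x :: 'a::complex_banach)"
  using scaleC_of_real[of "-1" x] by simp

lemma scaleC_Re_Im:
  fixes x :: "'a::complex_banach"
  shows "c *\<^sub>C x = Re c *\<^sub>R x + Im c *\<^sub>R (\<i> *\<^sub>C x)"
proof -
  have "c = complex_of_real (Re c) + complex_of_real (Im c) * \<i>"
    by (simp add: complex_eq_iff)
  then have "c *\<^sub>C x = complex_of_real (Re c) *\<^sub>C x + (complex_of_real (Im c) * \<i>) *\<^sub>C x"
    using scaleC_add_left[of "complex_of_real (Re c)" "complex_of_real (Im c) * \<i>" x] by simp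
  then show ?thesis by (simp add: scaleC_of_real flip: scaleC_scaleC)
qed

text \<open>
  The complex functional with real part \<open>F\<close> is \<open>F x - \<i> F (\<i> x)\<close>. Its norm is not larger because \<open>G x\<close> can be
  rotated to a nonnegative real number.
\<close>

lemma complexify_real_functional:
  fixes F :: "'a::complex_banach \<Rightarrow> real"
  assumes F: "linear F" "\<And>x. F x \<le> norm x"
  shows "\<exists>G\<in>dual_space (*\<^sub>C). \<forall>x. norm (G x) \<le> norm x \<and> Re (G x) = F x"
proof -
  define G where "G x = Complex (F x) (- F (\<i> *\<^sub>C x))" for x
  have Re_G: "Re (G x) = F x" for x by (simp add: G_def)
  have ii: "\<i> *\<^sub>C (\<i> *\<^sub>C x) = - x" for x :: 'a
    by (simp add: scaleC_scaleC scaleC_minus_one)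
  have i_scaleR: "\<i> *\<^sub>C (r *\<^sub>R x) = r *\<^sub>R (\<i> *\<^sub>C x)" for r and x :: 'a
    by (simp add: scaleC_scaleC mult.commute flip: scaleC_of_real)
  have add: "G (x + y) = G x + G y" for x y
    by (simp add: G_def complex_eq_iff scaleC_add_right linear_add[OF F(1)])
  have G_scaleR: "G (r *\<^sub>R x) = r *\<^sub>R G x" for r x
    by (simp add: G_def complex_eq_iff i_scaleR linear_scale[OF F(1)])
  have G_i: "G (\<i> *\<^sub>C x) = \<i> * G x" for x
    by (simp add: G_def complex_eq_iff ii linear_neg[OF F(1)])
  have G_scaleC: "G (c *\<^sub>C x) = c * G x" for c x
    by (subst scaleC_Re_Im) (simp add: add G_scaleR G_i complex_eq_iff)
  have bound: "norm (G x) \<le> norm x" for x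
  proof (cases "G x = 0")
    case False
    \<comment> \<open>The rotation that turns \<open>G x\<close> into its absolute value.\<close>
    define c where "c = cnj (G x) / norm (G x)"
    have "norm c = 1" using False by (simp add: c_def norm_divide)
    have "c * G x = norm (G x)"
      using False by (simp add: c_def complex_norm_square[symmetric] mult.commute power2_eq_square)
    then have "norm (G x) = Re (G (c *\<^sub>C x))" by (simp add: G_scaleC)
    also have "\<dots> \<le> norm (c *\<^sub>C x)" using F(2) by (simp add: Re_G)
    also have "\<dots> = norm x" using \<open>norm c = 1\<close> by (simp add: norm_scaleC)
    finally show ?thesis .
  qed simp
  have "bounded_linear G" by (rule bounded_linear_intro[of G 1]) (simp_all add: add G_scaleR bound)
  then show ?thesis using G_scaleC bound Re_G by (intro bexI[of _ G]) (simp_all add: dual_space_def)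
qed

lemma banach_scalars_complex: "banach_scalars ((*\<^sub>C) :: complex \<Rightarrow> 'a::complex_banach \<Rightarrow> 'a) Re"
proof (rule banach_scalars.intro)
  fix x :: 'a
  show "linear (\<lambda>c. c *\<^sub>C x)"
    by (intro linearI) (simp_all add: scaleC_add_left scaleR_conv_of_real flip: scaleC_scaleC scaleC_of_real)
next
  show "linear Re" by (intro linearI) simp_all
next
  show "\<bar>Re c\<bar> \<le> norm c" for c by (rule abs_Re_le_cmod)
next
  fix d :: complex assume "\<And>c. Re (c * d) \<le> 0"
  from this[of "cnj d"] have "(norm d)\<^sup>2 \<le> 0"
    unfolding cmod_power2 by (simp add: power2_eq_square)
  then show "d = 0" by simp
next
  fix F :: "'a \<Rightarrow> real" assume "linear F" "\<And>x. F x \<le> norm x"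
  then show "\<exists>G\<in>dual_space (*\<^sub>C). \<forall>x. norm (G x) \<le> norm x \<and> Re (G x) = F x"
    by (rule complexify_real_functional)
next
  fix E :: "nat set" and a :: "nat \<Rightarrow> complex" assume "finite E"
  then show "\<exists>F\<subseteq>E. (\<Sum>n\<in>E. norm (a n)) \<le> 4 * norm (\<Sum>n\<in>F. a n)"
    by (rule complex_large_partial_sum)
qed

theorem proposition3p2:
  fixes \<phi> :: "ordinal \<Rightarrow> nat \<Rightarrow> ordinal" and \<xi> :: ordinal
    and K :: "'a::banach set" and L :: "'b::complex_banach set"
  assumes "fundamental_sequences \<phi>" and "0 \<le> \<xi>" and "\<xi> \<le> omega1"
  shows
    "(xi_weakly_precompact ((*\<^sub>R) :: real \<Rightarrow> 'a \<Rightarrow> 'a) \<phi> \<xi> K \<longleftrightarrow>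
      xi_weakly_compact ((*\<^sub>R) :: real \<Rightarrow> 'a \<Rightarrow> 'a) \<phi> \<xi>
        (weak_topology ((*\<^sub>R) :: real \<Rightarrow> 'a \<Rightarrow> 'a) closure_of K)) \<and>
     (xi_weakly_precompact ((*\<^sub>C) :: complex \<Rightarrow> 'b \<Rightarrow> 'b) \<phi> \<xi> L \<longleftrightarrow>
      xi_weakly_compact ((*\<^sub>C) :: complex \<Rightarrow> 'b \<Rightarrow> 'b) \<phi> \<xi>
        (weak_topology ((*\<^sub>C) :: complex \<Rightarrow> 'b \<Rightarrow> 'b) closure_of L))"
  using banach_scalars.xi_weakly_precompact_iff_weak_closure_xi_weakly_compact[OF banach_scalars_real]
    banach_scalars.xi_weakly_precompact_iff_weak_closure_xi_weakly_compact[OF banach_scalars_complex]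
  by blast

end
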